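(* Let $R$ be a commutative local ring with $2\in R^\times$ and a non-trivial involution $\theta$, and suppose that $(n,\pi)\in\{(3,\mathrm{mid}),(3,\mathrm{ad}),(4,\mathrm{sc}),(4,\mathrm{ad})\}$. Then: (1) If $\mathcal E(R,\theta)\ne\{0\}$, then $t_\pi^{(n)}\notin E_\pi^{(n)}$. In particular, $E_\pi^{(n)}\neq G_\pi^{(n)}$. (2) Let $\delta\in\mathcal E(R,\theta)$. If there exists $\varphi\in\operatorname{Aut}(G_\pi^{(n)})$ such that $\varphi|_{E_\pi^{(n)}}=\Theta_\delta^{(n)}$, then $\delta=0$.
   Context: Notation. $J$ is the Jacobson radical of $R$; $\theta\colon r\mapsto\bar r$ is a ring automorphism with $\theta^2=\mathrm{id}$, $\theta\ne\mathrm{id}$. $R_\theta=\{r:\bar r=r\}$, $R_\theta^-=\{r:\bar r=-r\}$, $t^+=(t+\bar t)/2$, $m=n+1$. $E_{ij}$ are matrix units, $\bar A$ is entrywise application of $\theta$. $Q_4=E_{14}-E_{23}+E_{32}-E_{41}$, $Q_5=E_{15}-E_{24}+E_{33}-E_{42}+E_{51}$. $\mathcal E(R,\theta)=\{\delta\in J\cap R_\theta^-:\ \delta R_\theta^-=0,\ \delta(t^2-1)=0\ \text{for all } t\in R_\theta^\times\}$. Groups. $G_\pi(A_n,R)$ is the group of $R$-points of the Chevalley–Demazure group scheme of type $A_n$ of isogeny type $\pi$: $\mathrm{SL}_m$ (sc), $\mathrm{PGL}_m$ (ad), $\mathrm{SL}_4/\mu_2$ (mid, $n=3$). $G_\pi^{(n)}$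 is the fixed-point subgroup of the automorphism $\sigma$ of $G_\pi(A_n,R)$ induced by $A\mapsto Q_m(\bar A^t)^{-1}Q_m^{-1}$; so $G_{\mathrm{sc}}^{(n)}=\mathrm{SU}_m(R)=\{A\in\mathrm{SL}_m(R):AQ_m\bar A^t=Q_m\}$ and $G^{(n)}_{\mathrm{ad}}=\{[A]\in\mathrm{PGL}_m(R): AQ_m\bar A^t=\lambda Q_m\text{ for some }\lambda\in R^\times\}$. Root elements: for $n=3$ ($t\in R$, $s\in R_\theta$): $x_1(t)=I+tE_{12}+\bar tE_{34}$, $x_2(s)=I+sE_{23}$; for $n=4$ ($t\in R$; $(t,u)\in\mathcal A(R)=\{(t,u)\in R^2:t\bar t=u+\bar u\}$): $x_1(t)=I+tE_{12}+\bar tE_{45}$, $x_2(t,u)=I+tE_{23}+\bar tE_{34}+uE_{24}$; $x_{-i}(\cdot)$ is obtained from $x_i(\cdot)$ by replacing each $E_{jk}$ by $E_{kj}$. $E^{(n)}_{\mathrm{sc}}\subseteq\mathrm{SU}_m(R)$ is the subgroup generated by all $x_{\pm1}(\cdot),x_{\pm2}(\cdot)$; $E_\pi^{(n)}$ is its natural image in $G_\pi^{(n)}$. Torus elements. $t^{(3)}_\pi$ ($\pi\in\{\mathrm{mid},\mathrm{ad}\}$) is the image of $\operatorname{diag}(1,1,-1,-1)\in\mathrm{SL}_4(R)$ in $G_\pi(A_3,R)$; it lies in $G_\pi^{(3)}$. $t^{(4)}_\pi$ ($\pi\in\{\mathrm{sc},\mathrm{ad}\}$) is the image of $\operatorname{diag}(1,-1,1,-1,1)\in\mathrm{SU}_5(R)$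 in $G_\pi^{(4)}$. Exceptional automorphism. For $\delta\in\mathcal E(R,\theta)$, $\Theta_\delta^{(n)}$ is the automorphism of $E^{(n)}_{\mathrm{sc}}$ given on generators as follows ($p=t^+$); it fixes the center pointwise and induces an automorphism, denoted the same, of each $E_\pi^{(n)}$. $n=3$: $x_1(t)\mapsto I+tE_{12}+\bar tE_{34}-p\delta(E_{13}+E_{24}+E_{31}+E_{42})-p^2\delta(E_{14}+E_{32})$; $x_{-1}(t)\mapsto I+tE_{21}+\bar tE_{43}+p\delta(E_{13}+E_{24}+E_{31}+E_{42})+p^2\delta(E_{23}+E_{41})$; $x_2(s)\mapsto(1+2s\delta)(E_{11}+E_{44})+(1+s\delta)(E_{22}+E_{33})+(s+s^2\delta)E_{23}$; $x_{-2}(s)\mapsto(1-2s\delta)(E_{11}+E_{44})+(1-s\delta)(E_{22}+E_{33})+(s-s^2\delta)E_{32}$. $n=4$: $x_{\pm1}(t)\mapsto\operatorname{diag}(1\pm p\delta,1\pm p\delta,1\mp p\delta,1\pm p\delta,1\pm p\delta)\,x_{\pm1}(t)$; $x_2(t,u)\mapsto x_2(t,u)-p\delta(E_{13}+E_{53}+E_{31}+E_{35})+p^2\delta(E_{14}+E_{54}+E_{21}+E_{25})$; $x_{-2}(t,u)\mapsto x_{-2}(t,u)+p\delta(E_{13}+E_{53}+E_{31}+E_{35})-p^2\delta(E_{12}+E_{52}+E_{41}+E_{45})$. *)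

theory Defs
  imports "HOL-Analysis.Determinants" "HOL-Algebra.QuotRing" "HOL-Algebra.Generated_Groups"
begin

section \<open>Local rings with involution\<close>

text \<open>A ring given by a type, as a ring in the sense of the library's ideal theory.\<close>

definition type_ring :: "'r::comm_ring_1 ring" where
  "type_ring = \<lparr>carrier = UNIV, monoid.mult = (*), one = 1, ring.zero = 0, add = (+)\<rparr>"

definition local_ring :: "'r::comm_ring_1 itself \<Rightarrow> bool" where
  "local_ring _ \<longleftrightarrow> (\<exists>!M::'r set. maximalideal M type_ring)"

definition jacobson_radical :: "'r::comm_ring_1 set" where
  "jacobson_radical = \<Inter> {M. maximalideal M type_ring}"

definition ring_involution :: "('r::comm_ring_1 \<Rightarrow> 'r) \<Rightarrow> bool" where
  "ring_involution \<theta> \<longleftrightarrow>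
     \<theta> \<in> ring_iso type_ring type_ring \<and> \<theta> \<circ> \<theta> = id"

definition fixed_part :: "('r::comm_ring_1 \<Rightarrow> 'r) \<Rightarrow> 'r set" where
  "fixed_part \<theta> = {r. \<theta> r = r}"

definition skew_part :: "('r::comm_ring_1 \<Rightarrow> 'r) \<Rightarrow> 'r set" where
  "skew_part \<theta> = {r. \<theta> r = - r}"

text \<open>\<open>(t + \<theta> t) / 2\<close>; the description is unique whenever \<open>2\<close> is a unit.\<close>

definition sym_part :: "('r::comm_ring_1 \<Rightarrow> 'r) \<Rightarrow> 'r \<Rightarrow> 'r" where
  "sym_part \<theta> t = (THE p. 2 * p = t + \<theta> t)"

text \<open>An element of the fixed ring that is a unit of the big ring is a unit of the fixed
  ring (its inverse is fixed too), so \<open>t dvd 1\<close> may be tested in the big ring.\<close>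

definition exceptional_set :: "('r::comm_ring_1 \<Rightarrow> 'r) \<Rightarrow> 'r set" where
  "exceptional_set \<theta> =
     {\<delta> \<in> jacobson_radical \<inter> skew_part \<theta>.
        (\<forall>r\<in>skew_part \<theta>. \<delta> * r = 0) \<and>
        (\<forall>t\<in>fixed_part \<theta>. t dvd 1 \<longrightarrow> \<delta> * (t\<^sup>2 - 1) = 0)}"


section \<open>Matrices\<close>

text \<open>Rows and columns are indexed by the numeral types \<open>4\<close> and \<open>5\<close>, whose elements are
  \<open>1, \<dots>, 4\<close> and \<open>1, \<dots>, 5\<close>; the last index is also \<open>0\<close>, since numerals
  are read modulo the size of the type.\<close>

definition munit :: "'m \<Rightarrow> 'm \<Rightarrow> 'r::comm_ring_1^'m^'m" where
  "munit i j = (\<chi> k l. if k = i \<and> l = j then 1 else 0)"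

definition mscale :: "'r::comm_ring_1 \<Rightarrow> 'r^'m^'m \<Rightarrow> 'r^'m^'m"  (infixr \<open>*\<^sub>m\<close> 70) where
  "c *\<^sub>m A = (\<chi> i j. c * A $ i $ j)"

definition entrywise :: "('r \<Rightarrow> 'r) \<Rightarrow> 'r^'m^'m \<Rightarrow> 'r^'m^'m" where
  "entrywise \<theta> A = (\<chi> i j. \<theta> (A $ i $ j))"

definition diag4 :: "'r \<Rightarrow> 'r \<Rightarrow> 'r \<Rightarrow> 'r \<Rightarrow> 'r::comm_ring_1^4^4" where
  "diag4 a b c d =
     a *\<^sub>m munit 1 1 + b *\<^sub>m munit 2 2 + c *\<^sub>m munit 3 3 + d *\<^sub>m munit 4 4"

definition diag5 :: "'r \<Rightarrow> 'r \<Rightarrow> 'r \<Rightarrow> 'r \<Rightarrow> 'r \<Rightarrow> 'r::comm_ring_1^5^5" where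
  "diag5 a b c d e =
     a *\<^sub>m munit 1 1 + b *\<^sub>m munit 2 2 + c *\<^sub>m munit 3 3 + d *\<^sub>m munit 4 4 + e *\<^sub>m munit 5 5"

text \<open>The Kronecker square, i.e. the matrix of \<open>A \<otimes> A\<close>.\<close>

definition kron_square :: "'r::comm_ring_1^'m^'m \<Rightarrow> 'r^('m \<times> 'm)^('m \<times> 'm)" where
  "kron_square A = (\<chi> a b. A $ fst a $ fst b * A $ snd a $ snd b)"


section \<open>Chevalley--Demazure groups of type A\<close>

definition GL :: "('r::comm_ring_1^'m^'m) monoid" where
  "GL = \<lparr>carrier = {A. invertible A}, mult = (**), one = mat 1\<rparr>"

definition SL :: "('r::comm_ring_1^'m^'m) monoid" where
  "SL = GL\<lparr>carrier := {A. det A = 1}\<rparr>"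

definition scalars :: "('r::comm_ring_1^'m^'m) set" where
  "scalars = {mat c |c. c dvd 1}"

text \<open>For a local ring every point of the group scheme \<open>PGL\<^sub>m\<close> is the class of an
  invertible matrix.\<close>

definition PGL :: "('r::comm_ring_1^'m^'m) set monoid" where
  "PGL = GL Mod scalars"

text \<open>The group of points of the group scheme \<open>SL\<^sub>4 / \<mu>\<^sub>2\<close>, which is strictly larger than the
  abstract quotient of \<open>SL\<^sub>4(R)\<close> in general.  The coordinate ring of the scheme is the ring of
  \<open>\<mu>\<^sub>2\<close>-invariants in \<open>\<int>[x\<^sub>i\<^sub>j] / (det - 1)\<close>, that is, its even part.  This is generated by the
  products \<open>x\<^sub>i\<^sub>j x\<^sub>k\<^sub>l\<close>, subject to the relations of the second Veronese ring (the first two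
  conditions below) and to \<open>det = 1\<close> written in terms of these products.  A point is given by the
  images \<open>Y $ (i,k) $ (j,l)\<close> of the \<open>x\<^sub>i\<^sub>j x\<^sub>k\<^sub>l\<close>; the comultiplication becomes matrix
  multiplication, and \<open>SL\<^sub>4(R)\<close> maps to it by \<open>A \<mapsto> A \<otimes> A\<close>.\<close>

definition SL4_mod_mu2 :: "('r::comm_ring_1^(4 \<times> 4)^(4 \<times> 4)) monoid" where
  "SL4_mod_mu2 =
     \<lparr>carrier = {Y.
        (\<forall>i j k l. Y $ (i,k) $ (j,l) = Y $ (k,i) $ (l,j)) \<and>
        (\<forall>i j k l i' j' k' l'.
           Y $ (i,k) $ (j,l) * Y $ (i',k') $ (j',l') =
           Y $ (i,i') $ (j,j') * Y $ (k,k') $ (l,l')) \<and>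
        (\<Sum>p | p permutes UNIV.
           of_int (sign p) * (Y $ (1,2) $ (p 1, p 2) * Y $ (3,4) $ (p 3, p 4))) = 1},
      mult = (**), one = mat 1\<rparr>"

text \<open>The class in \<open>PGL\<close> of an invertible matrix.\<close>

definition proj_ad :: "'r::comm_ring_1^'m^'m \<Rightarrow> ('r^'m^'m) set" where
  "proj_ad A = scalars #>\<^bsub>GL\<^esub> A"


section \<open>Twisted groups\<close>

definition Q4 :: "'r::comm_ring_1^4^4" where
  "Q4 = munit 1 4 - munit 2 3 + munit 3 2 - munit 4 1"

definition Q5 :: "'r::comm_ring_1^5^5" where
  "Q5 = munit 1 5 - munit 2 4 + munit 3 3 - munit 4 2 + munit 5 1"

definition sigma :: "('r::comm_ring_1 \<Rightarrow> 'r) \<Rightarrow> 'r^'m^'m \<Rightarrow> 'r^'m^'m \<Rightarrow> 'r^'m^'m" where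
  "sigma \<theta> Q A = Q ** matrix_inv (transpose (entrywise \<theta> A)) ** matrix_inv Q"

definition G_sc :: "('r::comm_ring_1 \<Rightarrow> 'r) \<Rightarrow> 'r^'m^'m \<Rightarrow> ('r^'m^'m) monoid" where
  "G_sc \<theta> Q = SL\<lparr>carrier := {A \<in> carrier SL. sigma \<theta> Q A = A}\<rparr>"

definition G_ad :: "('r::comm_ring_1 \<Rightarrow> 'r) \<Rightarrow> 'r^'m^'m \<Rightarrow> ('r^'m^'m) set monoid" where
  "G_ad \<theta> Q = PGL\<lparr>carrier := {C \<in> carrier PGL. sigma \<theta> Q ` C = C}\<rparr>"

definition G_mid :: "('r::comm_ring_1 \<Rightarrow> 'r) \<Rightarrow> ('r^(4 \<times> 4)^(4 \<times> 4)) monoid" where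
  "G_mid \<theta> =
     SL4_mod_mu2\<lparr>carrier := {Y \<in> carrier SL4_mod_mu2. sigma \<theta> (kron_square Q4) Y = Y}\<rparr>"


section \<open>Elementary subgroups\<close>

text \<open>Throughout, the root elements for negative roots are obtained by transposition.\<close>

definition x3_1 :: "('r::comm_ring_1 \<Rightarrow> 'r) \<Rightarrow> 'r \<Rightarrow> 'r^4^4" where
  "x3_1 \<theta> t = mat 1 + t *\<^sub>m munit 1 2 + \<theta> t *\<^sub>m munit 3 4"

definition x3_2 :: "'r::comm_ring_1 \<Rightarrow> 'r^4^4" where
  "x3_2 s = mat 1 + s *\<^sub>m munit 2 3"

definition x4_1 :: "('r::comm_ring_1 \<Rightarrow> 'r) \<Rightarrow> 'r \<Rightarrow> 'r^5^5" where
  "x4_1 \<theta> t = mat 1 + t *\<^sub>m munit 1 2 + \<theta> t *\<^sub>m munit 4 5"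

definition root_params :: "('r::comm_ring_1 \<Rightarrow> 'r) \<Rightarrow> ('r \<times> 'r) set" where
  "root_params \<theta> = {(t, u). t * \<theta> t = u + \<theta> u}"

definition x4_2 :: "('r::comm_ring_1 \<Rightarrow> 'r) \<Rightarrow> 'r \<Rightarrow> 'r \<Rightarrow> 'r^5^5" where
  "x4_2 \<theta> t u = mat 1 + t *\<^sub>m munit 2 3 + \<theta> t *\<^sub>m munit 3 4 + u *\<^sub>m munit 2 4"

definition E3_sc :: "('r::comm_ring_1 \<Rightarrow> 'r) \<Rightarrow> ('r^4^4) set" where
  "E3_sc \<theta> = generate (G_sc \<theta> Q4)
     ({x3_1 \<theta> t |t. True} \<union> {transpose (x3_1 \<theta> t) |t. True} \<union>
      {x3_2 s |s. s \<in> fixed_part \<theta>} \<union> {transpose (x3_2 s) |s. s \<in> fixed_part \<theta>})"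

definition E4_sc :: "('r::comm_ring_1 \<Rightarrow> 'r) \<Rightarrow> ('r^5^5) set" where
  "E4_sc \<theta> = generate (G_sc \<theta> Q5)
     ({x4_1 \<theta> t |t. True} \<union> {transpose (x4_1 \<theta> t) |t. True} \<union>
      {x4_2 \<theta> t u |t u. (t, u) \<in> root_params \<theta>} \<union>
      {transpose (x4_2 \<theta> t u) |t u. (t, u) \<in> root_params \<theta>})"

definition E3_mid :: "('r::comm_ring_1 \<Rightarrow> 'r) \<Rightarrow> ('r^(4 \<times> 4)^(4 \<times> 4)) set" where
  "E3_mid \<theta> = kron_square ` E3_sc \<theta>"

definition E3_ad :: "('r::comm_ring_1 \<Rightarrow> 'r) \<Rightarrow> ('r^4^4) set set" where
  "E3_ad \<theta> = proj_ad ` E3_sc \<theta>"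

definition E4_ad :: "('r::comm_ring_1 \<Rightarrow> 'r) \<Rightarrow> ('r^5^5) set set" where
  "E4_ad \<theta> = proj_ad ` E4_sc \<theta>"


section \<open>Torus elements\<close>

definition t3_mid :: "'r::comm_ring_1^(4 \<times> 4)^(4 \<times> 4)" where
  "t3_mid = kron_square (diag4 1 1 (-1) (-1))"

definition t3_ad :: "('r::comm_ring_1^4^4) set" where
  "t3_ad = proj_ad (diag4 1 1 (-1) (-1))"

definition t4_sc :: "'r::comm_ring_1^5^5" where
  "t4_sc = diag5 1 (-1) 1 (-1) 1"

definition t4_ad :: "('r::comm_ring_1^5^5) set" where
  "t4_ad = proj_ad t4_sc"


section \<open>The exceptional automorphisms\<close>

text \<open>A homomorphism given on generators is represented by its graph: the subgroup of the direct
  product generated by the pairs (generator, image of the generator).  This needs no proof that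
  the assignment on generators does extend to an automorphism.\<close>

definition Theta3_gens :: "('r::comm_ring_1 \<Rightarrow> 'r) \<Rightarrow> 'r \<Rightarrow> (('r^4^4) \<times> ('r^4^4)) set" where
  "Theta3_gens \<theta> \<delta> =
     {(x3_1 \<theta> t,
       mat 1 + t *\<^sub>m munit 1 2 + \<theta> t *\<^sub>m munit 3 4
         - (p * \<delta>) *\<^sub>m (munit 1 3 + munit 2 4 + munit 3 1 + munit 4 2)
         - (p\<^sup>2 * \<delta>) *\<^sub>m (munit 1 4 + munit 3 2)) |t p. p = sym_part \<theta> t} \<union>
     {(transpose (x3_1 \<theta> t),
       mat 1 + t *\<^sub>m munit 2 1 + \<theta> t *\<^sub>m munit 4 3
         + (p * \<delta>) *\<^sub>m (munit 1 3 + munit 2 4 + munit 3 1 + munit 4 2)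
         + (p\<^sup>2 * \<delta>) *\<^sub>m (munit 2 3 + munit 4 1)) |t p. p = sym_part \<theta> t} \<union>
     {(x3_2 s,
       (1 + 2 * s * \<delta>) *\<^sub>m (munit 1 1 + munit 4 4)
         + (1 + s * \<delta>) *\<^sub>m (munit 2 2 + munit 3 3)
         + (s + s\<^sup>2 * \<delta>) *\<^sub>m munit 2 3) |s. s \<in> fixed_part \<theta>} \<union>
     {(transpose (x3_2 s),
       (1 - 2 * s * \<delta>) *\<^sub>m (munit 1 1 + munit 4 4)
         + (1 - s * \<delta>) *\<^sub>m (munit 2 2 + munit 3 3)
         + (s - s\<^sup>2 * \<delta>) *\<^sub>m munit 3 2) |s. s \<in> fixed_part \<theta>}"

definition Theta4_gens :: "('r::comm_ring_1 \<Rightarrow> 'r) \<Rightarrow> 'r \<Rightarrow> (('r^5^5) \<times> ('r^5^5)) set" where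
  "Theta4_gens \<theta> \<delta> =
     {(x4_1 \<theta> t,
       diag5 (1 + p * \<delta>) (1 + p * \<delta>) (1 - p * \<delta>) (1 + p * \<delta>) (1 + p * \<delta>)
         ** x4_1 \<theta> t) |t p. p = sym_part \<theta> t} \<union>
     {(transpose (x4_1 \<theta> t),
       diag5 (1 - p * \<delta>) (1 - p * \<delta>) (1 + p * \<delta>) (1 - p * \<delta>) (1 - p * \<delta>)
         ** transpose (x4_1 \<theta> t)) |t p. p = sym_part \<theta> t} \<union>
     {(x4_2 \<theta> t u,
       x4_2 \<theta> t u
         - (p * \<delta>) *\<^sub>m (munit 1 3 + munit 5 3 + munit 3 1 + munit 3 5)
         + (p\<^sup>2 * \<delta>) *\<^sub>m (munit 1 4 + munit 5 4 + munit 2 1 + munit 2 5))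
       |t u p. (t, u) \<in> root_params \<theta> \<and> p = sym_part \<theta> t} \<union>
     {(transpose (x4_2 \<theta> t u),
       transpose (x4_2 \<theta> t u)
         + (p * \<delta>) *\<^sub>m (munit 1 3 + munit 5 3 + munit 3 1 + munit 3 5)
         - (p\<^sup>2 * \<delta>) *\<^sub>m (munit 1 2 + munit 5 2 + munit 4 1 + munit 4 5))
       |t u p. (t, u) \<in> root_params \<theta> \<and> p = sym_part \<theta> t}"

definition Theta3_sc :: "('r::comm_ring_1 \<Rightarrow> 'r) \<Rightarrow> 'r \<Rightarrow> (('r^4^4) \<times> ('r^4^4)) set" where
  "Theta3_sc \<theta> \<delta> = generate (G_sc \<theta> Q4 \<times>\<times> G_sc \<theta> Q4) (Theta3_gens \<theta> \<delta>)"

definition Theta4_sc :: "('r::comm_ring_1 \<Rightarrow> 'r) \<Rightarrow> 'r \<Rightarrow> (('r^5^5) \<times> ('r^5^5)) set" where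
  "Theta4_sc \<theta> \<delta> = generate (G_sc \<theta> Q5 \<times>\<times> G_sc \<theta> Q5) (Theta4_gens \<theta> \<delta>)"

text \<open>The graphs of the induced automorphisms of the images of the simply connected group.\<close>

definition Theta3_mid ::
  "('r::comm_ring_1 \<Rightarrow> 'r) \<Rightarrow> 'r \<Rightarrow> (('r^(4 \<times> 4)^(4 \<times> 4)) \<times> ('r^(4 \<times> 4)^(4 \<times> 4))) set" where
  "Theta3_mid \<theta> \<delta> = map_prod kron_square kron_square ` Theta3_sc \<theta> \<delta>"

definition Theta3_ad ::
  "('r::comm_ring_1 \<Rightarrow> 'r) \<Rightarrow> 'r \<Rightarrow> (('r^4^4) set \<times> ('r^4^4) set) set" where
  "Theta3_ad \<theta> \<delta> = map_prod proj_ad proj_ad ` Theta3_sc \<theta> \<delta>"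

definition Theta4_ad ::
  "('r::comm_ring_1 \<Rightarrow> 'r) \<Rightarrow> 'r \<Rightarrow> (('r^5^5) set \<times> ('r^5^5) set) set" where
  "Theta4_ad \<theta> \<delta> = map_prod proj_ad proj_ad ` Theta4_sc \<theta> \<delta>"

definition graph_on :: "('a \<Rightarrow> 'b) \<Rightarrow> 'a set \<Rightarrow> ('a \<times> 'b) set" where
  "graph_on f A = {(x, f x) |x. x \<in> A}"

end

theory Submission
  imports Defs
begin

text \<open>
  Let \<open>\<delta>\<close> be an exceptional element.  Then \<open>3\<delta> = 0\<close>, \<open>\<delta>\<^sup>2 = 0\<close>, \<open>\<delta> \<theta>(r) = \<delta> r\<close> and \<open>\<delta> r \<in> {0, \<delta>, -\<delta>}\<close> for
  all \<open>r\<close>, so if \<open>\<delta> \<noteq> 0\<close> then \<open>\<delta>R\<close> is a copy of the residue field, the field with three elements.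

  (1) For \<open>n = 3\<close> the torus element is a similitude of multiplier \<open>-1\<close>; a scalar multiple of it in
  the unitary group would make \<open>-1\<close> a norm, hence a square in the field with three elements.  For
  \<open>n = 4\<close> the unitary group acts on the \<open>90\<close> vectors of value \<open>1\<close> of the quadratic form over that
  field.  The root elements have order \<open>3\<close> modulo the annihilator of \<open>\<delta>\<close>, so they act by even
  permutations, whereas the torus element acts as a product of \<open>39\<close> transpositions.

  (2) The torus element \<open>t\<close> satisfies \<open>t x = x' t\<close> for \<open>x = x\<^bsub>\<plusminus>2\<^esub>(1)\<close>, \<open>x' = x\<^bsub>\<plusminus>2\<^esub>(-1)\<close> if \<open>n = 3\<close>, and for
  \<open>x = x\<^bsub>\<plusminus>1\<^esub>(1)\<close>, \<open>x' = x\<^bsub>\<plusminus>1\<^esub>(-1)\<close> if \<open>n = 4\<close>.  An extension \<open>\<phi>\<close> of \<open>\<Theta>\<^sub>\<delta>\<close> therefore gives an invertible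
  \<open>T = \<phi>(t)\<close> with \<open>T \<Theta>\<^sub>\<delta>(x) = \<lambda> \<Theta>\<^sub>\<delta>(x') T\<close>, where \<open>\<lambda> = 1\<close> by comparing traces.  Reading off a single
  row of these equations (the first for \<open>n = 3\<close>, the third for \<open>n = 4\<close>) shows that \<open>\<delta>\<close> kills that
  row of \<open>T\<close>, hence \<open>\<delta> = 0\<close>.
\<close>

section \<open>Local rings with an involution\<close>

lemma ring_involution_simps:
  fixes \<theta> :: "'r::comm_ring_1 \<Rightarrow> 'r"
  assumes "ring_involution \<theta>"
  shows "\<theta> (a + b) = \<theta> a + \<theta> b" "\<theta> (a * b) = \<theta> a * \<theta> b" "\<theta> 1 = 1" "\<theta> 0 = 0"
    "\<theta> (- a) = - \<theta> a" "\<theta> (a - b) = \<theta> a - \<theta> b" "\<theta> (\<theta> a) = a" "\<theta> (sum f S) = (\<Sum>i\<in>S. \<theta> (f i))"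
proof -
  have hom: "\<theta> \<in> ring_hom type_ring type_ring" and inv: "\<theta> \<circ> \<theta> = id"
    using assms by (auto simp: ring_involution_def ring_iso_def)
  show add: "\<theta> (a + b) = \<theta> a + \<theta> b" for a b
    using ring_hom_add[OF hom] by (simp add: type_ring_def)
  show "\<theta> (a * b) = \<theta> a * \<theta> b"
    using ring_hom_mult[OF hom] by (simp add: type_ring_def)
  show "\<theta> 1 = 1"
    using ring_hom_one[OF hom] by (simp add: type_ring_def)
  show zero: "\<theta> 0 = 0" using add[of 0 0] by simp
  show neg: "\<theta> (- a) = - \<theta> a" for a
    using add[of "- a" a] zero unfolding eq_neg_iff_add_eq_0 by simp
  show "\<theta> (a - b) = \<theta> a - \<theta> b" using add[of a "- b"] neg by simp
  show "\<theta> (\<theta> a) = a" using inv by (metis comp_apply id_apply)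
  show "\<theta> (sum f S) = (\<Sum>i\<in>S. \<theta> (f i))"
    by (induction S rule: infinite_finite_induct) (auto simp: zero add)
qed


section \<open>Maximal ideals and units\<close>

lemma cring_type_ring: "cring (type_ring :: 'r::comm_ring_1 ring)"
proof (rule cringI)
  show "abelian_group (type_ring :: 'r ring)"
  proof (rule abelian_groupI)
    fix x :: 'r
    show "\<exists>y\<in>carrier type_ring. y \<oplus>\<^bsub>type_ring\<^esub> x = \<zero>\<^bsub>type_ring\<^esub>"
      by (auto simp: type_ring_def intro: exI[of _ "- x"])
  qed (auto simp: type_ring_def algebra_simps)
  show "comm_monoid (type_ring :: 'r ring)"
    by (rule comm_monoidI) (auto simp: type_ring_def algebra_simps)
qed (auto simp: type_ring_def algebra_simps)

text \<open>Brings the library's notion of ideal into elementary terms; closure under negation is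
  the case \<open>r = - 1\<close> of the last clause.\<close>

lemma ideal_type_ring_iff:
  "ideal I (type_ring :: 'r::comm_ring_1 ring) \<longleftrightarrow>
     0 \<in> I \<and> (\<forall>a\<in>I. \<forall>b\<in>I. a + b \<in> I) \<and> (\<forall>a\<in>I. \<forall>r. r * a \<in> I)"
proof
  assume "ideal I (type_ring :: 'r ring)"
  then interpret ideal I "type_ring :: 'r ring" .
  show "0 \<in> I \<and> (\<forall>a\<in>I. \<forall>b\<in>I. a + b \<in> I) \<and> (\<forall>a\<in>I. \<forall>r. r * a \<in> I)"
    using additive_subgroup.zero_closed[OF additive_subgroup_axioms]
      additive_subgroup.a_closed[OF additive_subgroup_axioms] I_l_closed
    by (simp add: type_ring_def)
next
  assume I: "0 \<in> I \<and> (\<forall>a\<in>I. \<forall>b\<in>I. a + b \<in> I) \<and> (\<forall>a\<in>I. \<forall>r. r * a \<in> I)"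
  interpret cring "type_ring :: 'r ring" by (rule cring_type_ring)
  have minus: "\<ominus>\<^bsub>type_ring\<^esub> x = - x" for x :: 'r
    by (rule minus_equality) (auto simp: type_ring_def)
  show "ideal I (type_ring :: 'r ring)"
  proof (rule idealI)
    show "subgroup I (add_monoid (type_ring :: 'r ring))"
    proof (rule add.subgroupI)
      show "I \<noteq> {}" using I by blast
      fix a b assume ab: "a \<in> I"  "b \<in> I"
      then show "a \<oplus>\<^bsub>type_ring\<^esub> b \<in> I" using I by (auto simp: type_ring_def)
    next
      fix a assume "a \<in> I"
      then have "(- 1) * a \<in> I" using I by blast
      then show "\<ominus>\<^bsub>type_ring\<^esub> a \<in> I" by (simp add: minus)
    qed (simp add: type_ring_def)
  next
    fix a x :: 'r
    assume "a \<in> I"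
    then have "x * a \<in> I" using I by blast
    then show "x \<otimes>\<^bsub>type_ring\<^esub> a \<in> I" "a \<otimes>\<^bsub>type_ring\<^esub> x \<in> I"
      by (simp_all add: type_ring_def mult.commute)
  qed (rule ring_axioms)
qed

text \<open>Zorn's lemma for the ideals that contain \<open>a\<close> but not 1. The multiples of
  \<open>a\<close> form such an ideal because \<open>a\<close> is no unit. An ideal strictly above a
  maximal member contains 1, so it is the whole ring.\<close>

lemma nonunit_in_maximalideal:
  fixes a :: "'r::comm_ring_1"
  assumes "\<not> a dvd 1"
  shows "\<exists>M. maximalideal M type_ring \<and> a \<in> M"
proof -
  define P where "P = {I. ideal I type_ring \<and> a \<in> I \<and> (1::'r) \<notin> I}"
  have "{r. a dvd r} \<in> P"
    using assms by (auto simp: P_def ideal_type_ring_iff)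
  then have "P \<noteq> {}" by blast
  moreover have "\<Union>C \<in> P" if "C \<noteq> {}" and C: "subset.chain P C" for C
  proof -
    have "\<And>I. I \<in> C \<Longrightarrow> I \<in> P" and lin: "\<And>I J. I \<in> C \<Longrightarrow> J \<in> C \<Longrightarrow> I \<subseteq> J \<or> J \<subseteq> I"
      using C unfolding subset_chain_def by blast+
    then have CP: "\<And>I. I \<in> C \<Longrightarrow> 0 \<in> I \<and> (\<forall>x\<in>I. \<forall>y\<in>I. x + y \<in> I) \<and> (\<forall>x\<in>I. \<forall>r. r * x \<in> I) \<and> a \<in> I \<and> 1 \<notin> I"
      by (auto simp: P_def ideal_type_ring_iff)
    have "x + y \<in> \<Union>C" if xy: "x \<in> \<Union>C" "y \<in> \<Union>C" for x y
    proof -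
      obtain I J where IJ: "I \<in> C" "x \<in> I" "J \<in> C" "y \<in> J" using xy by blast
      show ?thesis
      proof (cases "I \<subseteq> J")
        case True
        then show ?thesis using IJ CP[OF IJ(3)] by blast
      next
        case False
        then show ?thesis using IJ CP[OF IJ(1)] lin[OF IJ(1,3)] by blast
      qed
    qed
    moreover have "0 \<in> \<Union>C" "a \<in> \<Union>C" "1 \<notin> \<Union>C"
      using CP \<open>C \<noteq> {}\<close> by blast+
    moreover have "r * x \<in> \<Union>C" if "x \<in> \<Union>C" for x r
      using that CP by blast
    ultimately show ?thesis unfolding P_def ideal_type_ring_iff by blast
  qed
  ultimately obtain M where M: "M \<in> P" and max: "\<And>X. X \<in> P \<Longrightarrow> M \<subseteq> X \<Longrightarrow> X = M"
    using subset_Zorn_nonempty[of P] by metis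
  have "maximalideal M type_ring"
  proof (rule maximalidealI)
    fix J :: "'r set"
    assume J: "ideal J type_ring" "M \<subseteq> J"
    show "J = M \<or> J = carrier type_ring"
    proof (cases "1 \<in> J")
      case True
      then have "r * 1 \<in> J" for r using J by (auto simp only: ideal_type_ring_iff)
      then show ?thesis by (auto simp: type_ring_def)
    next
      case False
      then show ?thesis using M J max[of J] by (auto simp: P_def)
    qed
  qed (use M in \<open>auto simp: P_def type_ring_def\<close>)
  then show ?thesis using M by (auto simp: P_def)
qed

text \<open>In a local ring the maximal ideals around \<open>a\<close> and \<open>b\<close> are the
  same one, so the sum lies in a proper ideal.\<close>

lemma local_ring_nonunit_add:
  fixes a b :: "'r::comm_ring_1"
  assumes "local_ring TYPE('r)" "\<not> a dvd 1" "\<not> b dvd 1"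
  shows "\<not> (a + b) dvd 1"
proof
  assume "(a + b) dvd 1"
  then obtain c where c: "1 = (a + b) * c" by (auto elim: dvdE)
  obtain M where M: "maximalideal M (type_ring :: 'r ring)" "a \<in> M" "b \<in> M"
    using assms nonunit_in_maximalideal unfolding local_ring_def by metis
  then have I: "ideal M (type_ring :: 'r ring)" and "M \<noteq> UNIV"
    using maximalideal.axioms(1)[OF M(1)] maximalideal.I_notcarr[OF M(1)] by (auto simp: type_ring_def)
  have "c * (a + b) \<in> M" using I M by (auto simp only: ideal_type_ring_iff)
  then have "r * 1 \<in> M" for r
    using I c by (metis ideal_type_ring_iff mult.commute)
  then show False using \<open>M \<noteq> UNIV\<close> by auto
qed

text \<open>Ensures that \<open>exceptional_set \<theta> \<noteq> {0}\<close> yields a nonzero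
  element: the set is never empty.\<close>

lemma zero_in_exceptional_set:
  fixes \<theta> :: "'r::comm_ring_1 \<Rightarrow> 'r"
  assumes "ring_involution \<theta>"
  shows "0 \<in> exceptional_set \<theta>"
proof -
  have "(0::'r) \<in> M" if "maximalideal M type_ring" for M
    using maximalideal.axioms(1)[OF that] by (simp add: ideal_type_ring_iff)
  then show ?thesis
    by (auto simp: exceptional_set_def jacobson_radical_def skew_part_def
      ring_involution_simps[OF assms])
qed

text \<open>Here \<open>\<delta>\<close> may vanish, so that one locale serves both claims: for (1)
  the lemmas assume \<open>\<delta> \<noteq> 0\<close> separately, for (2)
  \<open>\<delta> = 0\<close> is the conclusion.\<close>

locale exceptional_element =
  fixes \<theta> :: "'r::comm_ring_1 \<Rightarrow> 'r" and \<delta> :: 'r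
  assumes local: "local_ring TYPE('r)"
    and two_unit: "(2::'r) dvd 1"
    and inv: "ring_involution \<theta>"
    and exceptional: "\<delta> \<in> exceptional_set \<theta>"
begin

section \<open>Arithmetic of multiplication by an exceptional element\<close>

lemma cancel_two: "2 * a = 2 * b \<longleftrightarrow> a = (b :: 'r)"
proof
  assume ab: "2 * a = 2 * b"
  obtain h :: 'r where h: "1 = 2 * h" using two_unit by (auto elim: dvdE)
  have "a = h * (2 * a)" using h by (metis mult.assoc mult.commute mult_1)
  also have "\<dots> = b" unfolding ab using h by (metis mult.assoc mult.commute mult_1)
  finally show "a = b" .
qed auto

text \<open>The unit 2 is fixed by \<open>\<theta>\<close>, and
  \<open>2\<^sup>2 - 1 = 3\<close>.\<close>

lemma three_delta: "3 * \<delta> = 0"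
proof -
  have "(2::'r) \<in> fixed_part \<theta>"
    using ring_involution_simps(1)[OF inv, of 1 1] by (simp add: fixed_part_def ring_involution_simps[OF inv])
  then have "\<delta> * (2\<^sup>2 - 1) = 0"
    using exceptional two_unit unfolding exceptional_set_def by blast
  then show ?thesis by (simp add: mult.commute)
qed

text \<open>\<open>\<delta>\<close> is itself skew, and it kills every skew element.\<close>

lemma delta_square: "\<delta> * \<delta> = 0"
  using exceptional by (auto simp: exceptional_set_def)

text \<open>\<open>\<theta> r - r\<close> is skew. After multiplication by \<open>\<delta>\<close>
  the involution thus becomes invisible, and hermitian conditions turn into symmetric ones.\<close>

lemma delta_theta: "\<delta> * \<theta> r = \<delta> * r"
proof -
  have "\<theta> r - r \<in> skew_part \<theta>" by (simp add: skew_part_def ring_involution_simps[OF inv])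
  then have "\<delta> * (\<theta> r - r) = 0" using exceptional by (auto simp: exceptional_set_def)
  then show ?thesis by (simp add: algebra_simps)
qed

lemma unit_or_unit:
  assumes "(a + b :: 'r) dvd 1"
  shows "a dvd 1 \<or> b dvd 1"
  using local_ring_nonunit_add[OF local] assms by blast

lemma delta_mult_cases: "\<delta> * r = 0 \<or> \<delta> * r = \<delta> \<or> \<delta> * r = - \<delta>"
proof -
  have fixed: "\<delta> * s = 0 \<or> \<delta> * s = \<delta> \<or> \<delta> * s = - \<delta>" if "s \<in> fixed_part \<theta>" for s
  proof (cases "s dvd 1")
    case True
    then have *: "\<delta> * (s\<^sup>2 - 1) = 0" using that exceptional by (auto simp: exceptional_set_def)
    \<comment> \<open>The factors of \<open>1 - s\<^sup>2\<close> add up to the unit 2, so in a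
      local ring one of them is a unit and can be cancelled.\<close>
    have "(s + 1) + (1 - s) dvd 1" using two_unit by simp
    then consider "s + 1 dvd 1" | "1 - s dvd 1" using unit_or_unit by blast
    then show ?thesis
    proof cases
      case 1
      then obtain c where "1 = (s + 1) * c" by (auto elim: dvdE)
      moreover have "\<delta> * (s - 1) * ((s + 1) * c) = 0"
      proof -
        have "\<delta> * (s - 1) * ((s + 1) * c) = \<delta> * (s\<^sup>2 - 1) * c"
          by (simp add: power2_eq_square algebra_simps)
        then show ?thesis by (simp add: *)
      qed
      ultimately have "\<delta> * (s - 1) = 0" by (metis mult.right_neutral)
      then show ?thesis by (simp add: algebra_simps)
    next
      case 2
      then obtain c where "1 = (1 - s) * c" by (auto elim: dvdE)
      moreover have "\<delta> * (s + 1) * ((1 - s) * c) = - (\<delta> * (s\<^sup>2 - 1)) * c"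
        by (simp add: power2_eq_square algebra_simps)
      ultimately have "\<delta> * (s + 1) = 0" using * by (metis mult.right_neutral mult_zero_left neg_equal_0_iff_equal)
      then show ?thesis unfolding eq_neg_iff_add_eq_0 by (simp add: distrib_left)
    qed
  next
    case False
    have u: "1 + s dvd 1" "1 - s dvd 1"
      using unit_or_unit[of "1 + s" "- s"] unit_or_unit[of "1 - s" s] False by auto
    moreover have "1 + s \<in> fixed_part \<theta>" "1 - s \<in> fixed_part \<theta>"
      using that by (auto simp: fixed_part_def ring_involution_simps[OF inv])
    ultimately have "\<delta> * ((1 + s)\<^sup>2 - 1) = 0" "\<delta> * ((1 - s)\<^sup>2 - 1) = 0"
      using exceptional by (auto simp: exceptional_set_def)
    \<comment> \<open>The difference of the two equations is
      \<open>4 * \<delta> * s = 0\<close>.\<close>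
    then have "2 * (2 * (\<delta> * s)) = 2 * (2 * 0)"
      by (simp add: power2_eq_square algebra_simps)
    then show ?thesis by (simp only: cancel_two) simp
  qed
  have s: "r + \<theta> r \<in> fixed_part \<theta>"
    by (simp add: fixed_part_def ring_involution_simps[OF inv] add.commute)
  show ?thesis
  proof -
    \<comment> \<open>An arbitrary \<open>r\<close> reduces to the fixed element
      \<open>r + \<theta> r\<close>, which acts on \<open>\<delta>\<close> as \<open>2 * r\<close>,
      that is, as \<open>- r\<close>.\<close>
    have "\<delta> * r + \<delta> * (r + \<theta> r) = 3 * \<delta> * r"
      by (simp add: distrib_left delta_theta)
    then have "\<delta> * r = - (\<delta> * (r + \<theta> r))"
      unfolding eq_neg_iff_add_eq_0 by (simp add: three_delta)
    then show ?thesis using fixed[OF s] by auto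
  qed
qed

lemma delta_distinct:
  assumes "\<delta> \<noteq> 0"
  shows "\<delta> \<noteq> - \<delta>"
  using assms cancel_two[of \<delta> 0] unfolding eq_neg_iff_add_eq_0 by simp

lemma sym_part_eqI: "2 * p = t + \<theta> t \<Longrightarrow> sym_part \<theta> t = p"
  unfolding sym_part_def by (rule the_equality) (metis cancel_two)+

end


section \<open>Matrices over a ring with involution\<close>

definition conj_transpose :: "('r \<Rightarrow> 'r) \<Rightarrow> 'r^'m^'m \<Rightarrow> 'r^'m^'m" where
  "conj_transpose \<theta> A = transpose (entrywise \<theta> A)"

lemma mscale_component [simp]: "(c *\<^sub>m A) $ i $ j = c * A $ i $ j"
  by (simp add: mscale_def)

lemma mat_mult_eq_mscale: "mat c ** A = c *\<^sub>m (A :: 'r::comm_ring_1^'m::finite^'m)"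
  by (simp add: vec_eq_iff matrix_matrix_mult_def mat_def if_distrib[of "\<lambda>x. x * _"] cong: if_cong)

lemma mscale_simps:
  fixes A B :: "'r::comm_ring_1^'m::finite^'m"
  shows "(c *\<^sub>m A) ** B = c *\<^sub>m (A ** B)" "A ** (c *\<^sub>m B) = c *\<^sub>m (A ** B)"
    "c *\<^sub>m d *\<^sub>m A = (c * d) *\<^sub>m A" "1 *\<^sub>m A = A"
  by (simp_all add: vec_eq_iff matrix_matrix_mult_def sum_distrib_left mult_ac)

lemma conj_transpose_mult:
  assumes "ring_involution (\<theta> :: 'r::comm_ring_1 \<Rightarrow> 'r)"
  shows "conj_transpose \<theta> (A ** B) = conj_transpose \<theta> B ** conj_transpose \<theta> (A :: 'r^'m::finite^'m)"
  by (simp add: conj_transpose_def entrywise_def vec_eq_iff matrix_matrix_mult_def transpose_def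
    ring_involution_simps[OF assms] mult.commute)

lemma conj_transpose_mscale:
  assumes "ring_involution (\<theta> :: 'r::comm_ring_1 \<Rightarrow> 'r)"
  shows "conj_transpose \<theta> (c *\<^sub>m A :: 'r^'m::finite^'m) = \<theta> c *\<^sub>m conj_transpose \<theta> A"
  by (simp add: conj_transpose_def entrywise_def vec_eq_iff transpose_def
    ring_involution_simps[OF assms])

lemma conj_transpose_one:
  assumes "ring_involution (\<theta> :: 'r::comm_ring_1 \<Rightarrow> 'r)"
  shows "conj_transpose \<theta> (mat 1 :: 'r^'m::finite^'m) = mat 1"
  by (simp add: conj_transpose_def entrywise_def vec_eq_iff transpose_def mat_def
    ring_involution_simps[OF assms])

lemma matrix_inv_eqI:
  assumes "A ** B = mat 1" "B ** A = mat 1"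
  shows "matrix_inv A = (B :: 'r::comm_ring_1^'m::finite^'m)"
proof -
  have "A ** matrix_inv A = mat 1 \<and> matrix_inv A ** A = mat 1"
    unfolding matrix_inv_def by (rule someI[of _ B]) (use assms in simp)
  then show ?thesis by (metis assms(2) matrix_mul_assoc matrix_mul_lid matrix_mul_rid)
qed

text \<open>Solving the similitude equation for \<open>A\<close> gives
  \<open>A = \<nu> *\<^sub>m sigma \<theta> Q A\<close>. Multiplier 1 makes \<open>A\<close> a fixed
  point; multiplier -1 is the case of the torus element for n = 3.\<close>

lemma sigma_similitude:
  fixes A B Q Q' :: "'r::comm_ring_1^'m::finite^'m"
  assumes inv: "ring_involution \<theta>"
    and A: "A ** B = mat 1" "B ** A = mat 1"
    and Q: "Q ** Q' = mat 1" "Q' ** Q = mat 1"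
    and sim: "A ** Q ** conj_transpose \<theta> A = \<nu> *\<^sub>m Q" and "\<mu> * \<nu> = 1"
  shows "sigma \<theta> Q A = \<mu> *\<^sub>m A"
proof -
  let ?C = "conj_transpose \<theta>"
  have C: "?C A ** ?C B = mat 1" "?C B ** ?C A = mat 1"
    using A by (metis conj_transpose_one conj_transpose_mult inv)+
  have "\<nu> *\<^sub>m (Q ** ?C B ** Q') = (A ** Q ** ?C A) ** ?C B ** Q'"
    by (simp add: sim mscale_simps)
  also have "\<dots> = A ** Q ** (?C A ** ?C B) ** Q'" by (simp add: matrix_mul_assoc)
  also have "\<dots> = A ** (Q ** Q')" by (simp add: C matrix_mul_assoc)
  finally have "\<nu> *\<^sub>m (Q ** ?C B ** Q') = A" by (simp add: Q)
  then have "\<mu> *\<^sub>m A = \<mu> *\<^sub>m \<nu> *\<^sub>m (Q ** ?C B ** Q')" by simp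
  also have "\<dots> = Q ** ?C B ** Q'" using \<open>\<mu> * \<nu> = 1\<close> by (simp add: mscale_simps)
  also have "\<dots> = sigma \<theta> Q A"
    using matrix_inv_eqI[OF C] matrix_inv_eqI[OF Q]
    by (simp add: sigma_def conj_transpose_def)
  finally show ?thesis by simp
qed

text \<open>The fixed-point condition of \<open>sigma\<close> in multiplicative form, which can be
  checked entry by entry without computing inverses.\<close>

definition special_unitary :: "('r::comm_ring_1 \<Rightarrow> 'r) \<Rightarrow> 'r^'m::finite^'m \<Rightarrow> ('r^'m^'m) set" where
  "special_unitary \<theta> Q =
     {A. det A = 1 \<and> invertible A \<and> A ** Q ** conj_transpose \<theta> A = Q}"

lemma special_unitary_subset:
  fixes Q Q' :: "'r::comm_ring_1^'m::finite^'m"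
  assumes "ring_involution \<theta>" "Q ** Q' = mat 1" "Q' ** Q = mat 1"
  shows "special_unitary \<theta> Q \<subseteq> carrier (G_sc \<theta> Q)"
  using sigma_similitude[OF assms(1) _ _ assms(2,3), where \<nu> = 1 and \<mu> = 1]
  by (auto simp: mscale_simps special_unitary_def G_sc_def SL_def invertible_def)

lemma special_unitary_mult:
  assumes inv: "ring_involution \<theta>" and A: "A \<in> special_unitary \<theta> Q" and B: "B \<in> special_unitary \<theta> Q"
  shows "A ** B \<in> special_unitary \<theta> Q"
proof -
  let ?C = "conj_transpose \<theta>"
  have "A ** B ** Q ** ?C (A ** B) = A ** (B ** Q ** ?C B) ** ?C A"
    by (simp add: conj_transpose_mult[OF inv] matrix_mul_assoc)
  also have "\<dots> = Q" using A B by (simp add: special_unitary_def)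
  finally show ?thesis using A B by (simp add: special_unitary_def det_mul invertible_mult)
qed

lemma special_unitary_inverse:
  assumes inv: "ring_involution \<theta>" and A: "A \<in> special_unitary \<theta> Q" 
    and AB: "A ** B = mat 1" "B ** A = mat 1"
  shows "B \<in> special_unitary \<theta> Q"
proof -
  let ?C = "conj_transpose \<theta>"
  have C: "?C A ** ?C B = mat 1"
    using AB by (metis conj_transpose_one conj_transpose_mult inv)
  have "B ** Q ** ?C B = B ** (A ** Q ** ?C A) ** ?C B"
    using A by (simp add: special_unitary_def)
  also have "\<dots> = (B ** A) ** Q ** (?C A ** ?C B)" by (simp add: matrix_mul_assoc)
  also have "\<dots> = Q" by (simp add: AB C)
  finally have "B ** Q ** ?C B = Q" .
  moreover have "det A * det B = 1" using AB by (metis det_I det_mul)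
  then have "det B = 1" using A by (simp add: special_unitary_def)
  ultimately show ?thesis using AB by (auto simp: special_unitary_def invertible_def)
qed

text \<open>Induction over a generated subgroup in terms of matrix products and two-sided matrix
  inverses. Membership in \<open>special_unitary\<close> is carried along, so that the property
  \<open>P\<close> need only be multiplicative on unitary matrices.\<close>

lemma generate_G_sc_induct:
  fixes Q Q' :: "'r::comm_ring_1^'m::finite^'m"
  assumes "A \<in> generate (G_sc \<theta> Q) S"
    and S: "S \<subseteq> special_unitary \<theta> Q"
    and inv: "ring_involution \<theta>" "Q ** Q' = mat 1" "Q' ** Q = mat 1"
    and one: "P (mat 1)"
    and incl: "\<And>A. A \<in> S \<Longrightarrow> P A"
    and inverse: "\<And>A B. A \<in> S \<Longrightarrow> B \<in> special_unitary \<theta> Q \<Longrightarrow> A ** B = mat 1 \<Longrightarrow> B ** A = mat 1 \<Longrightarrow> P B"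
    and mult: "\<And>A B. A \<in> special_unitary \<theta> Q \<Longrightarrow> B \<in> special_unitary \<theta> Q \<Longrightarrow> P A \<Longrightarrow> P B \<Longrightarrow> P (A ** B)"
  shows "A \<in> special_unitary \<theta> Q \<and> P A"
  using assms(1)
proof (induction rule: generate.induct)
  case one
  have "mat 1 ** mat 1 = (mat 1 :: 'r^'m^'m)" by simp
  then have "mat 1 \<in> special_unitary \<theta> Q"
    by (simp add: special_unitary_def conj_transpose_one[OF inv(1)]
      invertible_def)
  then show ?case using assms(6) by (simp add: G_sc_def SL_def GL_def)
next
  case (incl A)
  then show ?case using S assms(7) by blast
next
  case (inv A)
  then have A: "A \<in> special_unitary \<theta> Q" using S by blast
  then obtain B where B: "A ** B = mat 1" "B ** A = mat 1"
    by (auto simp: special_unitary_def invertible_def)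
  then have U: "B \<in> special_unitary \<theta> Q" using special_unitary_inverse A assms(3) by blast
  \<comment> \<open>The inverse in a monoid is described as an element of the carrier, so
    \<open>B\<close> has to be placed there first.\<close>
  then have "B \<in> carrier (G_sc \<theta> Q)" using special_unitary_subset assms(3-5) by blast
  then have "inv\<^bsub>G_sc \<theta> Q\<^esub> A = B"
    unfolding m_inv_def using B
    by (intro the_equality)
      (auto simp: G_sc_def SL_def GL_def, metis matrix_mul_assoc matrix_mul_lid matrix_mul_rid)
  then show ?case using U inverse inv B by simp
next
  case (eng A B)
  then have "A ** B \<in> special_unitary \<theta> Q \<and> P (A ** B)"
    using special_unitary_mult[OF assms(3)] mult by blast
  then show ?case by (simp add: G_sc_def SL_def GL_def)
qed


section \<open>Adjoint groups\<close>

lemma proj_ad_iff: "B \<in> proj_ad A \<longleftrightarrow> (\<exists>c. c dvd 1 \<and> B = c *\<^sub>m A)"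
  by (auto simp: proj_ad_def r_coset_def scalars_def GL_def mat_mult_eq_mscale)

lemma proj_ad_refl: "A \<in> proj_ad A"
  unfolding proj_ad_iff by (rule exI[of _ 1]) (simp add: mscale_simps)

lemma proj_ad_eqD: "proj_ad A = proj_ad B \<Longrightarrow> \<exists>c. c dvd 1 \<and> A = c *\<^sub>m B"
  using proj_ad_refl proj_ad_iff by metis

lemma proj_ad_mult:
  fixes A B :: "'r::comm_ring_1^'m::finite^'m"
  shows "proj_ad A <#>\<^bsub>GL\<^esub> proj_ad B = proj_ad (A ** B)"
proof (intro Set.set_eqI iffI)
  fix C assume "C \<in> proj_ad A <#>\<^bsub>GL\<^esub> proj_ad B"
  then obtain a b where "a dvd 1" "b dvd 1" "C = (a *\<^sub>m A) ** (b *\<^sub>m B)"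
    by (auto simp: set_mult_def proj_ad_iff GL_def)
  then have "C = (a * b) *\<^sub>m (A ** B)" "a * b dvd 1"
    using mult_dvd_mono[of a 1 b 1] by (simp_all add: mscale_simps mult.commute)
  then show "C \<in> proj_ad (A ** B)" by (auto simp: proj_ad_iff)
next
  fix C assume "C \<in> proj_ad (A ** B)"
  then obtain c where c: "c dvd 1" "C = c *\<^sub>m (A ** B)"
    by (auto simp: proj_ad_iff)
  then have "C = (c *\<^sub>m A) ** B" by (simp add: mscale_simps)
  moreover have "c *\<^sub>m A \<in> proj_ad A" using c by (auto simp: proj_ad_iff)
  ultimately show "C \<in> proj_ad A <#>\<^bsub>GL\<^esub> proj_ad B"
    using proj_ad_refl by (fastforce simp: set_mult_def GL_def)
qed

lemma carrier_PGL: "carrier PGL = proj_ad ` {A. invertible (A :: 'r::comm_ring_1^'m::finite^'m)}"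
  by (auto simp: PGL_def FactGroup_def RCOSETS_def proj_ad_def GL_def)

text \<open>\<open>sigma\<close> sends \<open>c *\<^sub>m A\<close> to a scalar multiple of
  \<open>A\<close> whose factor is \<open>\<mu>\<close> times the conjugate of the inverse of
  \<open>c\<close>. As \<open>c\<close> runs through the units so does this factor, and the class of
  \<open>A\<close> is mapped onto itself.\<close>

lemma proj_ad_in_G_ad:
  fixes A B Q Q' :: "'r::comm_ring_1^'m::finite^'m"
  assumes inv: "ring_involution \<theta>"
    and A: "A ** B = mat 1" "B ** A = mat 1"
    and Q: "Q ** Q' = mat 1" "Q' ** Q = mat 1"
    and sim: "A ** Q ** conj_transpose \<theta> A = \<nu> *\<^sub>m Q" and \<nu>: "\<mu> * \<nu> = 1"
  shows "proj_ad A \<in> carrier (G_ad \<theta> Q)"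
proof -
  have \<nu>_unit: "\<mu> dvd 1" "\<nu> dvd 1" using \<nu> by (metis dvdI mult.commute)+
  have sigma: "sigma \<theta> Q (c *\<^sub>m A) = (\<mu> * \<theta> c') *\<^sub>m A" if c: "c * c' = 1" for c c'
  proof -
    have "sigma \<theta> Q (c *\<^sub>m A) = (\<mu> * (c' * \<theta> c')) *\<^sub>m (c *\<^sub>m A)"
    proof (rule sigma_similitude[OF inv _ _ Q])
      show "(c *\<^sub>m A) ** (c' *\<^sub>m B) = mat 1" "(c' *\<^sub>m B) ** (c *\<^sub>m A) = mat 1"
        using c by (simp_all add: mscale_simps A mult.commute)
      have "(c *\<^sub>m A) ** Q ** conj_transpose \<theta> (c *\<^sub>m A) = (c * \<theta> c) *\<^sub>m (A ** Q ** conj_transpose \<theta> A)"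
        by (simp add: conj_transpose_mult[OF inv] conj_transpose_mscale[OF inv] mscale_simps mult.commute)
      then show "(c *\<^sub>m A) ** Q ** conj_transpose \<theta> (c *\<^sub>m A) = (c * \<theta> c * \<nu>) *\<^sub>m Q"
        by (simp add: sim mscale_simps)
      have "\<theta> c * \<theta> c' = 1" using c ring_involution_simps[OF inv] by metis
      have "\<mu> * (c' * \<theta> c') * (c * \<theta> c * \<nu>) = (\<mu> * \<nu>) * (c * c') * (\<theta> c * \<theta> c')"
        by (simp add: mult_ac)
      also have "\<dots> = 1" by (simp add: \<nu> c \<open>\<theta> c * \<theta> c' = 1\<close>)
      finally show "\<mu> * (c' * \<theta> c') * (c * \<theta> c * \<nu>) = 1" .
    qed
    also have "\<dots> = ((c * c') * (\<mu> * \<theta> c')) *\<^sub>m A" by (simp add: mscale_simps mult_ac)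
    finally show ?thesis by (simp only: c mult_1)
  qed
  have "sigma \<theta> Q ` proj_ad A = proj_ad A"
  proof (intro Set.set_eqI iffI)
    fix D assume "D \<in> sigma \<theta> Q ` proj_ad A"
    then obtain c c' where c: "c * c' = 1" and D: "D = sigma \<theta> Q (c *\<^sub>m A)"
      unfolding proj_ad_iff image_iff by (metis dvdE proj_ad_iff)
    have "\<theta> c' * \<theta> c = 1" using c ring_involution_simps[OF inv] by (metis mult.commute)
    then have "\<mu> * \<theta> c' dvd 1" using \<nu>_unit mult_dvd_mono[of \<mu> 1 "\<theta> c'" 1] by (metis dvdI mult_1)
    then show "D \<in> proj_ad A" using sigma[OF c] D unfolding proj_ad_iff by metis
  next
    fix D assume "D \<in> proj_ad A"
    then obtain d d' where d: "d * d' = 1" and D: "D = d *\<^sub>m A"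
      unfolding proj_ad_iff by (metis dvdE)
    \<comment> \<open>Chosen as the solution of \<open>\<mu> * \<theta> c' = d\<close>, with
      \<open>c'\<close> the inverse of \<open>c\<close>.\<close>
    define c where "c = \<theta> (\<mu> * d')"
    define c' where "c' = \<theta> (\<nu> * d)"
    have "(\<mu> * d') * (\<nu> * d) = (\<mu> * \<nu>) * (d * d')" by (simp add: mult_ac)
    then have "(\<mu> * d') * (\<nu> * d) = 1" by (simp add: d \<nu>)
    then have c: "c * c' = 1"
      unfolding c_def c'_def using ring_involution_simps(2,3)[OF inv] by metis
    have "\<mu> * \<theta> c' = (\<mu> * \<nu>) * d" by (simp add: c'_def ring_involution_simps[OF inv] mult_ac)
    then have "D = sigma \<theta> Q (c *\<^sub>m A)" using sigma[OF c] D \<nu> by simp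
    moreover have "c *\<^sub>m A \<in> proj_ad A" unfolding proj_ad_iff by (metis c dvdI)
    ultimately show "D \<in> sigma \<theta> Q ` proj_ad A" by blast
  qed
  moreover have "proj_ad A \<in> carrier PGL"
    using A unfolding carrier_PGL invertible_def by blast
  ultimately show ?thesis by (simp add: G_ad_def)
qed


section \<open>Root elements are unitary\<close>

lemma exhaust_5: "(x :: 5) = 1 \<or> x = 2 \<or> x = 3 \<or> x = 4 \<or> x = 5"
proof (induction x)
  case (of_int z)
  then have "0 \<le> z" "z < 5" by simp_all
  then have "z = 0 \<or> z = 1 \<or> z = 2 \<or> z = 3 \<or> z = 4" by arith
  then show ?case by auto
qed

lemma forall_5: "(\<forall>i::5. P i) \<longleftrightarrow> P 1 \<and> P 2 \<and> P 3 \<and> P 4 \<and> P 5"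
  by (metis exhaust_5)

lemma UNIV_5: "UNIV = {1, 2, 3, 4, 5::5}"
  using exhaust_5 by auto

lemma sum_5: "sum f (UNIV::5 set) = f 1 + f 2 + f 3 + f 4 + f 5"
  unfolding UNIV_5 by (simp add: ac_simps)

lemma prod_4: "prod f (UNIV::4 set) = f 1 * f 2 * f 3 * f 4"
  unfolding UNIV_4 by (simp add: ac_simps)

lemma prod_5: "prod f (UNIV::5 set) = f 1 * f 2 * f 3 * f 4 * f 5"
  unfolding UNIV_5 by (simp add: ac_simps)

definition transvection :: "'m \<Rightarrow> 'm \<Rightarrow> 'r::comm_ring_1 \<Rightarrow> 'r^'m::finite^'m" where
  "transvection i j c = mat 1 + c *\<^sub>m munit i j"

text \<open>A transvection arises from the identity by one row operation. Root elements are written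
  as products of transvections to get their determinants.\<close>

lemma det_transvection:
  assumes "i \<noteq> j"
  shows "det (transvection i j c :: 'r::comm_ring_1^'m::finite^'m) = 1"
proof -
  have "transvection i j c = (\<chi> k. if k = i then row i (mat 1) + c *s row j (mat 1) else row k (mat 1 :: 'r^'m^'m))"
    by (auto simp: transvection_def vec_eq_iff mscale_def munit_def row_def mat_def)
  then show ?thesis using det_row_operation[OF assms, where A = "mat 1 :: 'r^'m^'m" and c = c] by simp
qed

text \<open>Breaks an identity of 4 by 4 matrices into its sixteen entries.\<close>

lemmas entries4 = vec_eq_iff forall_4 sum_4 matrix_matrix_mult_def transpose_def entrywise_def
  conj_transpose_def munit_def mscale_def mat_def diag4_def Q4_def x3_1_def x3_2_def

lemmas entries5 = vec_eq_iff forall_5 sum_5 matrix_matrix_mult_def transpose_def entrywise_def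
  conj_transpose_def munit_def mscale_def mat_def diag5_def Q5_def x4_1_def x4_2_def

lemma Q4_inverse: "Q4 ** (- Q4) = (mat 1 :: 'r::comm_ring_1^4^4)" "(- Q4) ** Q4 = (mat 1 :: 'r^4^4)"
  by (simp_all add: entries4)

lemma Q5_inverse: "Q5 ** Q5 = (mat 1 :: 'r::comm_ring_1^5^5)"
  by (simp add: entries5)

context
  fixes \<theta> :: "'r::comm_ring_1 \<Rightarrow> 'r"
  assumes inv: "ring_involution \<theta>"
begin

lemma x3_1_special_unitary: "x3_1 \<theta> t \<in> special_unitary \<theta> Q4"
proof -
  have "x3_1 \<theta> t = transvection 1 2 t ** transvection 3 4 (\<theta> t)"
    by (simp add: entries4 transvection_def)
  then have "det (x3_1 \<theta> t) = 1" by (simp add: det_mul det_transvection)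
  moreover have "x3_1 \<theta> t ** x3_1 \<theta> (- t) = mat 1" "x3_1 \<theta> (- t) ** x3_1 \<theta> t = mat 1"
    by (simp_all add: entries4 ring_involution_simps[OF inv])
  moreover have "x3_1 \<theta> t ** Q4 ** conj_transpose \<theta> (x3_1 \<theta> t) = Q4"
    by (simp add: entries4 ring_involution_simps[OF inv] if_distrib[of \<theta>])
  ultimately show ?thesis by (auto simp: special_unitary_def invertible_def)
qed


lemma x3_1_transpose_special_unitary: "transpose (x3_1 \<theta> t) \<in> special_unitary \<theta> Q4"
proof -
  have "transpose (x3_1 \<theta> t) ** transpose (x3_1 \<theta> (- t)) = mat 1"
    "transpose (x3_1 \<theta> (- t)) ** transpose (x3_1 \<theta> t) = mat 1"
    by (simp_all add: entries4 ring_involution_simps[OF inv])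
  moreover have "transpose (x3_1 \<theta> t) ** Q4 ** conj_transpose \<theta> (transpose (x3_1 \<theta> t)) = Q4"
    by (simp add: entries4 ring_involution_simps[OF inv] if_distrib[of \<theta>])
  ultimately show ?thesis
    using x3_1_special_unitary[of t] by (auto simp: special_unitary_def invertible_def)
qed

lemma x3_2_special_unitary:
  assumes "s \<in> fixed_part \<theta>"
  shows "x3_2 s \<in> special_unitary \<theta> Q4" "transpose (x3_2 s) \<in> special_unitary \<theta> Q4"
proof -
  have "det (x3_2 s) = 1" using det_transvection[of "2 :: 4" 3 s] by (simp add: x3_2_def transvection_def)
  moreover have "x3_2 s ** x3_2 (- s) = mat 1" "x3_2 (- s) ** x3_2 s = mat 1"
    "transpose (x3_2 s) ** transpose (x3_2 (- s)) = mat 1"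
    "transpose (x3_2 (- s)) ** transpose (x3_2 s) = mat 1"
    by (simp_all add: entries4)
  moreover have "x3_2 s ** Q4 ** conj_transpose \<theta> (x3_2 s) = Q4"
    "transpose (x3_2 s) ** Q4 ** conj_transpose \<theta> (transpose (x3_2 s)) = Q4"
    using assms
    by (simp_all add: entries4 ring_involution_simps[OF inv] if_distrib[of \<theta>] fixed_part_def)
  ultimately show "x3_2 s \<in> special_unitary \<theta> Q4" "transpose (x3_2 s) \<in> special_unitary \<theta> Q4"
    unfolding special_unitary_def invertible_def by (simp_all only: det_transpose mem_Collect_eq) blast+
qed

lemma x4_1_special_unitary:
  "x4_1 \<theta> t \<in> special_unitary \<theta> Q5" "transpose (x4_1 \<theta> t) \<in> special_unitary \<theta> Q5"
proof -
  have "x4_1 \<theta> t = transvection 1 2 t ** transvection 4 5 (\<theta> t)"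
    by (simp add: entries5 transvection_def)
  then have "det (x4_1 \<theta> t) = 1" by (simp add: det_mul det_transvection)
  moreover have "x4_1 \<theta> t ** x4_1 \<theta> (- t) = mat 1" "x4_1 \<theta> (- t) ** x4_1 \<theta> t = mat 1"
    "transpose (x4_1 \<theta> t) ** transpose (x4_1 \<theta> (- t)) = mat 1"
    "transpose (x4_1 \<theta> (- t)) ** transpose (x4_1 \<theta> t) = mat 1"
    by (simp_all add: entries5 ring_involution_simps[OF inv])
  moreover have "x4_1 \<theta> t ** Q5 ** conj_transpose \<theta> (x4_1 \<theta> t) = Q5"
    "transpose (x4_1 \<theta> t) ** Q5 ** conj_transpose \<theta> (transpose (x4_1 \<theta> t)) = Q5"
    by (simp_all add: entries5 ring_involution_simps[OF inv] if_distrib[of \<theta>])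
  ultimately show "x4_1 \<theta> t \<in> special_unitary \<theta> Q5" "transpose (x4_1 \<theta> t) \<in> special_unitary \<theta> Q5"
    unfolding special_unitary_def invertible_def by (simp_all only: det_transpose mem_Collect_eq) blast+
qed

lemma x4_2_special_unitary:
  assumes "(t, u) \<in> root_params \<theta>"
  shows "x4_2 \<theta> t u \<in> special_unitary \<theta> Q5" "transpose (x4_2 \<theta> t u) \<in> special_unitary \<theta> Q5"
proof -
  have tu: "\<theta> u = t * \<theta> t - u"
    using assms by (simp add: root_params_def)
  \<comment> \<open>The factor at (3,4) stands to the left of the one at (2,3): in the opposite
    order an extra \<open>t * \<theta> t\<close> would appear at (2,4).\<close>
  have "x4_2 \<theta> t u = transvection 3 4 (\<theta> t) ** transvection 2 3 t ** transvection 2 4 u"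
    by (simp add: entries5 transvection_def)
  then have "det (x4_2 \<theta> t u) = 1" by (simp add: det_mul det_transvection)
  \<comment> \<open>The (2,4) entry of the inverse is \<open>t * \<theta> t - u\<close>, which is
    \<open>\<theta> u\<close> by the relation between the parameters.\<close>
  moreover have "x4_2 \<theta> t u ** x4_2 \<theta> (- t) (\<theta> u) = mat 1" "x4_2 \<theta> (- t) (\<theta> u) ** x4_2 \<theta> t u = mat 1"
    "transpose (x4_2 \<theta> t u) ** transpose (x4_2 \<theta> (- t) (\<theta> u)) = mat 1"
    "transpose (x4_2 \<theta> (- t) (\<theta> u)) ** transpose (x4_2 \<theta> t u) = mat 1"
    by (simp_all add: entries5 ring_involution_simps[OF inv] tu algebra_simps)
  moreover have "x4_2 \<theta> t u ** Q5 ** conj_transpose \<theta> (x4_2 \<theta> t u) = Q5"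
    "transpose (x4_2 \<theta> t u) ** Q5 ** conj_transpose \<theta> (transpose (x4_2 \<theta> t u)) = Q5"
    by (simp_all add: entries5 ring_involution_simps[OF inv] if_distrib[of \<theta>] tu algebra_simps)
  ultimately show "x4_2 \<theta> t u \<in> special_unitary \<theta> Q5" "transpose (x4_2 \<theta> t u) \<in> special_unitary \<theta> Q5"
    unfolding special_unitary_def invertible_def by (simp_all only: det_transpose mem_Collect_eq) blast+
qed

end


section \<open>Intertwiners of the exceptional images\<close>

text \<open>A row of a matrix with a right inverse generates the unit ideal: it has product 1 with
  the matching column of \<open>T'\<close>.\<close>

lemma prod_inverse_row_zero:
  fixes T :: "'r::comm_ring_1^'m::finite^'m"
  assumes "T ** T' = mat 1" and "\<And>j. d * T $ i $ j = 0"
  shows "d = 0"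
proof -
  have "d = d * (T ** T') $ i $ i" by (simp add: assms(1)) (simp add: mat_def)
  also have "\<dots> = (\<Sum>k\<in>UNIV. d * T $ i $ k * T' $ k $ i)"
    by (simp add: matrix_matrix_mult_def sum_distrib_left mult.assoc)
  also have "\<dots> = 0" by (simp add: assms(2))
  finally show ?thesis .
qed

text \<open>\<open>A\<close> is \<open>c\<close> times a conjugate of \<open>B\<close>, so
  \<open>trace A = c * trace B\<close>, and a unit trace can be cancelled. This removes the scalar
  ambiguity in the adjoint groups.\<close>

lemma intertwiner_scalar_one:
  fixes T A B :: "'r::comm_ring_1^'m::finite^'m"
  assumes "T ** A = c *\<^sub>m (B ** T)" "T ** T' = mat 1" "T' ** T = mat 1"
    and "trace A = trace B" "trace B dvd 1"
  shows "c = 1"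
proof -
  have "A = T' ** T ** A" using assms(3) by simp
  also have "\<dots> = c *\<^sub>m (T' ** (B ** T))"
    using assms(1) by (simp add: mscale_simps flip: matrix_mul_assoc)
  finally have "A = c *\<^sub>m (T' ** (B ** T))" .
  moreover have "trace (c *\<^sub>m X) = c * trace X" for X :: "'r^'m^'m"
    by (simp add: trace_def sum_distrib_left)
  ultimately have "trace A = c * trace (T' ** (B ** T))" by simp
  also have "trace (T' ** (B ** T)) = trace (B ** T ** T')" by (rule trace_mul_sym)
  also have "\<dots> = trace B" using assms(2) by (simp flip: matrix_mul_assoc)
  finally have *: "trace B = c * trace B" using assms(4) by simp
  obtain h where h: "1 = trace B * h" using assms(5) by (elim dvdE)
  have "c = c * (trace B * h)" using h by simp
  also have "\<dots> = (c * trace B) * h" by (rule mult.assoc[symmetric])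
  also have "\<dots> = trace B * h" using * by simp
  finally show ?thesis using h by simp
qed

text \<open>The images under \<open>\<Theta>\<^sub>\<delta>\<close> of \<open>x\<^bsub>\<plusminus>2\<^esub>(s)\<close> for \<open>n = 3\<close>, and of \<open>x\<^bsub>\<plusminus>1\<^esub>(p)\<close> for \<open>n = 4\<close> when \<open>p\<close> is fixed
  by \<open>\<theta>\<close> (so that \<open>p\<^sup>+ = p\<close>).\<close>

definition y3_pos :: "'r::comm_ring_1 \<Rightarrow> 'r \<Rightarrow> 'r^4^4" where
  "y3_pos \<delta> s = (1 + 2 * s * \<delta>) *\<^sub>m (munit 1 1 + munit 4 4)
         + (1 + s * \<delta>) *\<^sub>m (munit 2 2 + munit 3 3)
         + (s + s\<^sup>2 * \<delta>) *\<^sub>m munit 2 3"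

definition y3_neg :: "'r::comm_ring_1 \<Rightarrow> 'r \<Rightarrow> 'r^4^4" where
  "y3_neg \<delta> s = (1 - 2 * s * \<delta>) *\<^sub>m (munit 1 1 + munit 4 4)
         + (1 - s * \<delta>) *\<^sub>m (munit 2 2 + munit 3 3)
         + (s - s\<^sup>2 * \<delta>) *\<^sub>m munit 3 2"

definition y4_pos :: "('r::comm_ring_1 \<Rightarrow> 'r) \<Rightarrow> 'r \<Rightarrow> 'r \<Rightarrow> 'r^5^5" where
  "y4_pos \<theta> \<delta> p = diag5 (1 + p * \<delta>) (1 + p * \<delta>) (1 - p * \<delta>) (1 + p * \<delta>) (1 + p * \<delta>) ** x4_1 \<theta> p"

definition y4_neg :: "('r::comm_ring_1 \<Rightarrow> 'r) \<Rightarrow> 'r \<Rightarrow> 'r \<Rightarrow> 'r^5^5" where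
  "y4_neg \<theta> \<delta> p = diag5 (1 - p * \<delta>) (1 - p * \<delta>) (1 + p * \<delta>) (1 - p * \<delta>) (1 - p * \<delta>) ** transpose (x4_1 \<theta> p)"

context exceptional_element
begin

lemma delta_double: "2 * \<delta> = - \<delta>"
proof -
  have "2 * \<delta> + \<delta> = 3 * \<delta>" by simp
  then show ?thesis unfolding eq_neg_iff_add_eq_0 by (simp add: three_delta)
qed

lemma delta_mult_eq_zeroI: "2 * (\<delta> * a) = 0 \<Longrightarrow> \<delta> * a = 0"
  using cancel_two[of "\<delta> * a" 0] by simp

lemma delta_mult_delta: "\<delta> * (\<delta> * a) = 0"
  by (simp add: delta_square flip: mult.assoc)

text \<open>Multiplying the hypothesis by \<open>\<delta>\<close> leaves only
  \<open>\<delta> * a\<close>, since \<open>\<delta>\<close> squares to zero.\<close>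

lemma delta_kills:
  assumes "a + \<delta> * a = 0 \<or> a - \<delta> * a = 0"
  shows "\<delta> * a = 0"
proof -
  have "\<delta> * (a + \<delta> * a) = 0 \<or> \<delta> * (a - \<delta> * a) = 0" using assms by auto
  then show ?thesis by (simp add: distrib_left right_diff_distrib delta_mult_delta)
qed

lemma delta_mult_left: "b * \<delta> = \<delta> * b" "b * (\<delta> * a) = \<delta> * (b * a)" 
  by (simp_all add: mult_ac)

text \<open>Since \<open>2 * \<delta> = - \<delta>\<close>, the outer and inner diagonal entries
  become \<open>1 - \<delta>\<close> and \<open>1 + \<delta>\<close>, in one order or the
  other.\<close>

lemma y3_entries:
  "y3_pos \<delta> 1 = (1 - \<delta>) *\<^sub>m (munit 1 1 + munit 4 4) + (1 + \<delta>) *\<^sub>m (munit 2 2 + munit 3 3 + munit 2 3)"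
  "y3_pos \<delta> (- 1) = (1 + \<delta>) *\<^sub>m (munit 1 1 + munit 4 4) + (1 - \<delta>) *\<^sub>m (munit 2 2 + munit 3 3 - munit 2 3)"
  "y3_neg \<delta> 1 = (1 + \<delta>) *\<^sub>m (munit 1 1 + munit 4 4) + (1 - \<delta>) *\<^sub>m (munit 2 2 + munit 3 3 + munit 3 2)"
  "y3_neg \<delta> (- 1) = (1 - \<delta>) *\<^sub>m (munit 1 1 + munit 4 4) + (1 + \<delta>) *\<^sub>m (munit 2 2 + munit 3 3 - munit 3 2)"
  by (simp_all add: y3_pos_def y3_neg_def entries4 delta_double)

lemma delta_eq_zero_3:
  assumes T: "T ** T' = mat 1"
    and pos: "T ** y3_pos \<delta> 1 = y3_pos \<delta> (- 1) ** T"
    and neg: "T ** y3_neg \<delta> 1 = y3_neg \<delta> (- 1) ** T"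
  shows "\<delta> = 0"
proof -
  \<comment> \<open>The first row of \<open>y3_pos \<delta> (- 1)\<close> is
    \<open>1 + \<delta>\<close> times a unit vector, and that of
    \<open>y3_neg \<delta> (- 1)\<close> is \<open>1 - \<delta>\<close> times the same vector, so
    the right-hand sides involve only the first row of \<open>T\<close>.\<close>
  have p: "(T ** y3_pos \<delta> 1) $ 1 $ j = (y3_pos \<delta> (- 1) ** T) $ 1 $ j"
    and n: "(T ** y3_neg \<delta> 1) $ 1 $ j = (y3_neg \<delta> (- 1) ** T) $ 1 $ j" for j
    by (simp_all only: pos neg)
  note expand = y3_entries entries4 algebra_simps
  have "\<delta> * T $ 1 $ 1 = 0"
    using p[of 1] by (intro delta_mult_eq_zeroI) (simp add: expand)
  moreover have "\<delta> * T $ 1 $ 4 = 0"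
    using p[of 4] by (intro delta_mult_eq_zeroI) (simp add: expand)
  moreover have "\<delta> * T $ 1 $ 2 = 0"
    using p[of 3] by (intro delta_kills) (simp add: expand)
  moreover have "\<delta> * T $ 1 $ 3 = 0"
    using n[of 2] by (intro delta_kills) (simp add: expand)
  ultimately have "\<forall>j. \<delta> * T $ 1 $ j = 0" by (simp add: forall_4)
  then show ?thesis using prod_inverse_row_zero[OF T] by blast
qed

lemma trace_y3:
  "trace (y3_pos \<delta> 1) = 4" "trace (y3_pos \<delta> (- 1)) = 4"
  "trace (y3_neg \<delta> 1) = 4" "trace (y3_neg \<delta> (- 1)) = 4"
  by (simp_all add: y3_entries trace_def entries4)

lemma delta_eq_zero_3_ad:
  assumes T: "T ** T' = mat 1" "T' ** T = mat 1"
    and pos: "T ** y3_pos \<delta> 1 = c *\<^sub>m (y3_pos \<delta> (- 1) ** T)"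
    and neg: "T ** y3_neg \<delta> 1 = d *\<^sub>m (y3_neg \<delta> (- 1) ** T)"
  shows "\<delta> = 0"
proof -
  have "(4::'r) dvd 1" using mult_dvd_mono[OF two_unit two_unit] by simp
  then have "c = 1" "d = 1"
    using intertwiner_scalar_one[OF pos T] intertwiner_scalar_one[OF neg T] by (simp_all add: trace_y3)
  then show ?thesis using delta_eq_zero_3[OF T(1)] pos neg by (simp add: mscale_simps)
qed

lemma y4_entries:
  "y4_pos \<theta> \<delta> 1 = diag5 (1 + \<delta>) (1 + \<delta>) (1 - \<delta>) (1 + \<delta>) (1 + \<delta>) + (1 + \<delta>) *\<^sub>m (munit 1 2 + munit 4 5)"
  "y4_pos \<theta> \<delta> (- 1) = diag5 (1 - \<delta>) (1 - \<delta>) (1 + \<delta>) (1 - \<delta>) (1 - \<delta>) - (1 - \<delta>) *\<^sub>m (munit 1 2 + munit 4 5)"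
  "y4_neg \<theta> \<delta> 1 = diag5 (1 - \<delta>) (1 - \<delta>) (1 + \<delta>) (1 - \<delta>) (1 - \<delta>) + (1 - \<delta>) *\<^sub>m (munit 2 1 + munit 5 4)"
  "y4_neg \<theta> \<delta> (- 1) = diag5 (1 + \<delta>) (1 + \<delta>) (1 - \<delta>) (1 + \<delta>) (1 + \<delta>) - (1 + \<delta>) *\<^sub>m (munit 2 1 + munit 5 4)"
  by (simp_all add: y4_pos_def y4_neg_def entries5 ring_involution_simps[OF inv])

lemma delta_eq_zero_4:
  assumes T: "T ** T' = mat 1"
    and pos: "T ** y4_pos \<theta> \<delta> 1 = y4_pos \<theta> \<delta> (- 1) ** T"
    and neg: "T ** y4_neg \<theta> \<delta> 1 = y4_neg \<theta> \<delta> (- 1) ** T"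
  shows "\<delta> = 0"
proof -
  \<comment> \<open>The index 3 is untouched by the off-diagonal entries, so the third row of
    \<open>T\<close> is merely scaled by \<open>1 + \<delta>\<close> or \<open>1 - \<delta>\<close>
    on the right-hand side.\<close>
  have p: "(T ** y4_pos \<theta> \<delta> 1) $ 3 $ j = (y4_pos \<theta> \<delta> (- 1) ** T) $ 3 $ j"
    and n: "(T ** y4_neg \<theta> \<delta> 1) $ 3 $ j = (y4_neg \<theta> \<delta> (- 1) ** T) $ 3 $ j" for j
    by (simp_all only: pos neg)
  note expand = y4_entries entries5 algebra_simps
  have "\<delta> * T $ 3 $ 3 = 0"
    using p[of 3] by (intro delta_mult_eq_zeroI) (simp add: expand)
  moreover have "\<delta> * T $ 3 $ 1 = 0"
    using p[of 2] by (intro delta_kills) (simp add: expand)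
  moreover have "\<delta> * T $ 3 $ 4 = 0"
    using p[of 5] by (intro delta_kills) (simp add: expand)
  moreover have "\<delta> * T $ 3 $ 2 = 0"
    using n[of 1] by (intro delta_kills) (simp add: expand)
  moreover have "\<delta> * T $ 3 $ 5 = 0"
    using n[of 4] by (intro delta_kills) (simp add: expand)
  ultimately have "\<forall>j. \<delta> * T $ 3 $ j = 0" unfolding forall_5 by blast
  then show ?thesis using prod_inverse_row_zero[OF T] by blast
qed

lemma trace_y4:
  "trace (y4_pos \<theta> \<delta> 1) = 5" "trace (y4_pos \<theta> \<delta> (- 1)) = 5"
  "trace (y4_neg \<theta> \<delta> 1) = 5" "trace (y4_neg \<theta> \<delta> (- 1)) = 5"
proof -
  have "5 + 3 * \<delta> = 5" "5 - 3 * \<delta> = 5" by (simp_all add: three_delta)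
  then show "trace (y4_pos \<theta> \<delta> 1) = 5" "trace (y4_pos \<theta> \<delta> (- 1)) = 5"
    "trace (y4_neg \<theta> \<delta> 1) = 5" "trace (y4_neg \<theta> \<delta> (- 1)) = 5"
    by (simp_all add: y4_entries trace_def entries5 algebra_simps)
qed

text \<open>The sum of 5 and -3 is the unit 2, and -3 is no unit because it kills a nonzero
  element.\<close>

lemma five_unit:
  assumes "\<delta> \<noteq> 0"
  shows "(5::'r) dvd 1"
proof (rule ccontr)
  assume "\<not> (5::'r) dvd 1"
  moreover have "\<not> (- 3 :: 'r) dvd 1"
  proof
    assume "(- 3 :: 'r) dvd 1"
    then obtain h :: 'r where "1 = - 3 * h" by (elim dvdE)
    then have "\<delta> = \<delta> * (- 3 * h)" by simp
    also have "\<dots> = - (3 * \<delta>) * h" by (simp add: mult_ac)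
    finally show False using assms by (simp add: three_delta)
  qed
  ultimately show False using unit_or_unit[of 5 "- 3"] two_unit by simp
qed

lemma delta_eq_zero_4_ad:
  assumes T: "T ** T' = mat 1" "T' ** T = mat 1"
    and pos: "T ** y4_pos \<theta> \<delta> 1 = c *\<^sub>m (y4_pos \<theta> \<delta> (- 1) ** T)"
    and neg: "T ** y4_neg \<theta> \<delta> 1 = d *\<^sub>m (y4_neg \<theta> \<delta> (- 1) ** T)"
  shows "\<delta> = 0"
\<comment> \<open>The trace 5 is known to be a unit only when
  \<open>\<delta> \<noteq> 0\<close>.\<close>
proof (rule ccontr)
  assume "\<delta> \<noteq> 0"
  then have "c = 1" "d = 1"
    using intertwiner_scalar_one[OF pos T] intertwiner_scalar_one[OF neg T] five_unit
    by (simp_all add: trace_y4)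
  then have "\<delta> = 0" using delta_eq_zero_4[OF T(1)] pos neg by (simp add: mscale_simps)
  then show False using \<open>\<delta> \<noteq> 0\<close> by simp
qed

end


section \<open>The group of intermediate type\<close>

lemma sum_UNIV_pair:
  "sum f (UNIV :: ('a::finite \<times> 'b::finite) set) = (\<Sum>p\<in>UNIV. \<Sum>q\<in>UNIV. f (p, q))"
  by (simp add: sum.cartesian_product flip: UNIV_Times_UNIV)

lemma kron_square_component: "kron_square A $ (i, k) $ (j, l) = A $ i $ j * A $ k $ l"
  by (simp add: kron_square_def)

lemma kron_square_mult:
  fixes A B :: "'r::comm_ring_1^'m::finite^'m"
  shows "kron_square (A ** B) = kron_square A ** kron_square B"
  by (simp add: vec_eq_iff kron_square_component matrix_matrix_mult_def sum_UNIV_pair sum_product mult_ac)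

lemma kron_square_one: "kron_square (mat 1) = (mat 1 :: 'r::comm_ring_1^('m::finite \<times> 'm)^('m \<times> 'm))"
  by (auto simp: vec_eq_iff kron_square_component mat_def)

lemma kron_square_mscale: "kron_square (c *\<^sub>m A) = (c * c) *\<^sub>m kron_square (A :: 'r::comm_ring_1^'m::finite^'m)"
  by (simp add: vec_eq_iff kron_square_component mult_ac)

lemma kron_square_conj_transpose:
  assumes "ring_involution \<theta>"
  shows "conj_transpose \<theta> (kron_square A) = kron_square (conj_transpose \<theta> (A :: 'r::comm_ring_1^'m::finite^'m))"
  by (simp add: vec_eq_iff kron_square_component conj_transpose_def transpose_def entrywise_def
    ring_involution_simps[OF assms])

text \<open>Each Leibniz term of the determinant has four factors, which are grouped two by two as
  entries of the Kronecker square.\<close>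

lemma kron_square_in_SL4_mod_mu2:
  assumes "det A = 1"
  shows "kron_square A \<in> carrier SL4_mod_mu2"
proof -
  have "(\<Sum>p | p permutes (UNIV :: 4 set). of_int (sign p) *
      (kron_square A $ (1, 2) $ (p 1, p 2) * kron_square A $ (3, 4) $ (p 3, p 4))) = det A"
    by (simp add: det_def prod_4 kron_square_component mult.assoc)
  then show ?thesis using assms by (simp add: SL4_mod_mu2_def kron_square_component mult_ac)
qed

text \<open>The Kronecker square squares the multiplier, so similitudes of multiplier -1 become
  fixed points too.\<close>

lemma kron_square_in_G_mid:
  fixes A B :: "'r::comm_ring_1^4^4"
  assumes inv: "ring_involution \<theta>"
    and A: "A ** B = mat 1" "B ** A = mat 1" "det A = 1"
    and sim: "A ** Q4 ** conj_transpose \<theta> A = \<nu> *\<^sub>m Q4" and \<nu>: "\<nu> * \<nu> = 1"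
  shows "kron_square A \<in> carrier (G_mid \<theta>)"
proof -
  have "sigma \<theta> (kron_square Q4) (kron_square A) = 1 *\<^sub>m kron_square A"
  proof (rule sigma_similitude[OF inv])
    show "kron_square A ** kron_square B = mat 1" "kron_square B ** kron_square A = mat 1"
      "kron_square Q4 ** kron_square (- Q4) = (mat 1 :: 'r^(4 \<times> 4)^(4 \<times> 4))"
      "kron_square (- Q4) ** kron_square Q4 = (mat 1 :: 'r^(4 \<times> 4)^(4 \<times> 4))"
      by (simp_all add: A Q4_inverse kron_square_one flip: kron_square_mult)
    show "kron_square A ** kron_square Q4 ** conj_transpose \<theta> (kron_square A) = 1 *\<^sub>m kron_square Q4"
      by (simp add: kron_square_conj_transpose[OF inv] sim kron_square_mscale \<nu> flip: kron_square_mult)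
  qed simp
  then show ?thesis
    using kron_square_in_SL4_mod_mu2[OF A(3)] by (simp add: G_mid_def mscale_simps)
qed

context exceptional_element
begin

lemma delta_double_left: "2 * (\<delta> * a) = - (\<delta> * a)" "\<delta> * (2 * a) = - (\<delta> * a)" "\<delta> * 2 = - \<delta>"
  "\<delta> * (3 * a) = 0"
proof -
  have "(2 * \<delta>) * a = - (\<delta> * a)" by (simp add: delta_double)
  then show "2 * (\<delta> * a) = - (\<delta> * a)" "\<delta> * (2 * a) = - (\<delta> * a)" "\<delta> * 2 = - \<delta>"
    using delta_double by (simp_all only: mult_ac)
  have "(3 * \<delta>) * a = 0" by (simp add: three_delta)
  then show "\<delta> * (3 * a) = 0" by (simp only: mult_ac)
qed

text \<open>\<open>Y\<close> is not assumed to be the Kronecker square of a matrix, so the 4 by 4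
  argument is repeated with row (1,1) in place of row 1. Of the equations of
  \<open>SL4_mod_mu2\<close> only the symmetry under swapping the tensor factors enters; it makes
  \<open>y\<close> symmetric.\<close>

lemma delta_eq_zero_3_mid:
  fixes Y :: "'r^(4 \<times> 4)^(4 \<times> 4)"
  assumes Y: "Y ** Y' = mat 1" and sym: "\<And>i j k l. Y $ (i, k) $ (j, l) = Y $ (k, i) $ (l, j)"
    and pos: "Y ** kron_square (y3_pos \<delta> 1) = kron_square (y3_pos \<delta> (- 1)) ** Y"
    and neg: "Y ** kron_square (y3_neg \<delta> 1) = kron_square (y3_neg \<delta> (- 1)) ** Y"
  shows "\<delta> = 0"
proof -
  define y where "y j l = Y $ (1, 1) $ (j, l)" for j l
  have y_sym: "y j l = y l j" for j l using sym by (simp add: y_def)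
  have expand: "(Y ** kron_square a) $ (1, 1) $ (j, l) = (\<Sum>p\<in>UNIV. \<Sum>q\<in>UNIV. y p q * (a $ p $ j * a $ q $ l))"
    "(kron_square b ** Y) $ (1, 1) $ (j, l) = (\<Sum>p\<in>UNIV. \<Sum>q\<in>UNIV. b $ 1 $ p * b $ 1 $ q * Y $ (p, q) $ (j, l))"
    for a b j l
    by (simp_all add: matrix_matrix_mult_def sum_UNIV_pair kron_square_component y_def)
  have p: "(\<Sum>p\<in>UNIV. \<Sum>q\<in>UNIV. y p q * (y3_pos \<delta> 1 $ p $ j * y3_pos \<delta> 1 $ q $ l)) = (1 + \<delta>) * (1 + \<delta>) * y j l" for j l
    using arg_cong[OF pos, of "\<lambda>M. M $ (1, 1) $ (j, l)"] unfolding expand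
    by (simp add: y3_entries munit_def sum_4 y_def)
  have n: "(\<Sum>p\<in>UNIV. \<Sum>q\<in>UNIV. y p q * (y3_neg \<delta> 1 $ p $ j * y3_neg \<delta> 1 $ q $ l)) = (1 - \<delta>) * (1 - \<delta>) * y j l" for j l
    using arg_cong[OF neg, of "\<lambda>M. M $ (1, 1) $ (j, l)"] unfolding expand
    by (simp add: y3_entries munit_def sum_4 y_def)
  \<comment> \<open>The comparisons rest on \<open>(1 + \<delta>)\<^sup>2 = 1 - \<delta>\<close>,
    \<open>(1 - \<delta>)\<^sup>2 = 1 + \<delta>\<close> and
    \<open>(1 + \<delta>) * (1 - \<delta>) = 1\<close>.\<close>
  note ex = y3_entries munit_def sum_4 algebra_simps delta_mult_delta delta_square delta_double_left
  have outer: "\<delta> * y j l = 0" if "j = 1 \<or> j = 4" "l = 1 \<or> l = 4" for j l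
    using p[of j l] that by (auto simp: ex)
  have mixed: "\<delta> * y j 2 = 0" "\<delta> * y j 3 = 0" if "j = 1 \<or> j = 4" for j
    using p[of j 2] n[of j 3] that by (auto simp: ex)
  have d22: "\<delta> * y 2 2 = 0" using p[of 2 3] by (intro delta_kills) (simp add: ex)
  have d33: "\<delta> * y 3 3 = 0" using n[of 3 2] by (intro delta_kills) (simp add: ex)
  \<comment> \<open>Column 3 of \<open>y3_pos \<delta> 1\<close> is a multiple of the sum of the
    unit vectors 2 and 3; in the expansion \<open>y 3 3\<close> cancels, and symmetry merges
    \<open>y 2 3\<close> with \<open>y 3 2\<close>.\<close>
  have "y 2 2 + 2 * y 2 3 - \<delta> * (y 2 2 + 2 * y 2 3) = 0" using p[of 3 3] y_sym[of 3 2] by (simp add: ex)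
  then have "\<delta> * (y 2 2 + 2 * y 2 3) = 0" by (intro delta_kills) simp
  then have d23: "\<delta> * y 2 3 = 0" by (simp add: distrib_left d22 delta_double_left delta_mult_left)
  have "\<forall>j l. \<delta> * y j l = 0"
    unfolding forall_4 using outer mixed d22 d33 d23 y_sym by metis
  then have "\<And>a. \<delta> * Y $ (1, 1) $ a = 0" by (auto simp: y_def)
  then show ?thesis using prod_inverse_row_zero[OF Y] by blast
qed

end


section \<open>A sign character on the unitary group in dimension 5\<close>

text \<open>Such a \<open>p\<close> is a product of \<open>card M div 2\<close> disjoint
  transpositions. The induction splits off one pair \<open>a\<close>, \<open>p a\<close> and turns
  it into fixed points of \<open>q\<close>.\<close>

lemma sign_involution:
  assumes "finite M" "\<And>x. x \<in> M \<Longrightarrow> p x \<in> M \<and> p x \<noteq> x \<and> p (p x) = x" "\<And>x. x \<notin> M \<Longrightarrow> p x = x"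
  shows "even (card M) \<and> sign p = (- 1) ^ (card M div 2)"
  using assms
proof (induction "card M" arbitrary: M p rule: less_induct)
  case less
  show ?case
  proof (cases "M = {}")
    case True
    then have "p = id" using less.prems by auto
    then show ?thesis using True by simp
  next
    case False
    then obtain a where a: "a \<in> M" by blast
    define b where "b = p a"
    have b: "b \<in> M" "b \<noteq> a" "p b = a" using less.prems(2)[OF a] by (auto simp: b_def)
    define N where "N = M - {a, b}"
    define q where "q = p(a := a, b := b)"
    have card: "card M = card N + 2"
      using a b less.prems(1) card_Diff_subset[of "{a, b}" M] card_mono[of M "{a, b}"]
      by (simp add: N_def)
    have qN: "q x \<in> N \<and> q x \<noteq> x \<and> q (q x) = x" if "x \<in> N" for x
    proof -
      have x: "x \<in> M" "x \<noteq> a" "x \<noteq> b" using that by (auto simp: N_def)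
      then have "p x \<noteq> a" "p x \<noteq> b" using less.prems(2)[OF x(1)] less.prems(2)[OF a] b b_def by metis+
      then show ?thesis using less.prems(2)[OF x(1)] x by (auto simp: N_def q_def)
    qed
    have qout: "q x = x" if "x \<notin> N" for x
      using that less.prems(3) by (auto simp: N_def q_def)
    have IH: "even (card N) \<and> sign q = (- 1) ^ (card N div 2)"
      using card less.prems(1) qN qout by (intro less.hyps) (auto simp: N_def)
    have "p = Transposition.transpose a b \<circ> q"
    proof
      fix x
      show "p x = (Transposition.transpose a b \<circ> q) x"
      proof (cases "x \<in> N")
        case True
        then have "q x \<noteq> a" "q x \<noteq> b" "q x = p x" using qN[OF True] by (auto simp: N_def q_def)
        then show ?thesis by simp
      next
        case False
        then have "x = a \<or> x = b \<or> x \<notin> M" by (auto simp: N_def)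
        moreover have "x \<notin> M \<Longrightarrow> x \<noteq> a \<and> x \<noteq> b" using a b by blast
        ultimately show ?thesis using qout[OF False] less.prems(3) b b_def by auto
      qed
    qed
    moreover have "q permutes N"
    proof (rule bij_imp_permutes)
      show "bij_betw q N N" by (rule bij_betw_byWitness[where f' = q]) (use qN in auto)
    qed (rule qout)
    then have "permutation q" 
      using less.prems(1) permutation_permutes by (auto simp: N_def)
    ultimately have "sign p = - sign q"
      using b by (simp add: sign_compose permutation_swap_id sign_swap_id)
    then show ?thesis using IH card by simp
  qed
qed

text \<open>The vectors of value \<open>1\<close> of the form \<open>Q\<^sub>5\<close> over the field with three elements.\<close>

definition residue_vectors :: "(int \<times> int \<times> int \<times> int \<times> int) list" where
  "residue_vectors =
     filter (\<lambda>(a, b, c, d, e). (2 * a * e - 2 * b * d + c * c) mod 3 = 1)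
       (let k = [- 1, 0, 1] in List.product k (List.product k (List.product k (List.product k k))))"

lemma distinct_residue_vectors: "distinct residue_vectors"
  by (simp add: residue_vectors_def Let_def distinct_product)

text \<open>Found by enumeration. These are the vectors moved by the torus element, which negates
  \<open>b\<close> and \<open>d\<close>; half of 78 is odd.\<close>

lemma length_moved_residue_vectors:
  "length (filter (\<lambda>(a, b, c, d, e). b \<noteq> 0 \<or> d \<noteq> 0) residue_vectors) = 78"
  unfolding residue_vectors_def by code_simp

lemma set_residue_vectors:
  "set residue_vectors = {(a, b, c, d, e).
     {a, b, c, d, e} \<subseteq> {- 1, 0, 1} \<and> (2 * a * e - 2 * b * d + c * c) mod 3 = 1}"
proof -
  have "set (filter P (List.product k (List.product k (List.product k (List.product k k))))) =
      {(a, b, c, d, e). {a, b, c, d, e} \<subseteq> set k \<and> P (a, b, c, d, e)}" for P and k :: "int list"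
    by auto
  then show ?thesis by (simp only: residue_vectors_def Let_def list.set prod.case)
qed

section \<open>Quadratic forms on row vectors\<close>

definition quadratic_value :: "'r::comm_ring_1^'m::finite^'m \<Rightarrow> 'r^'m \<Rightarrow> 'r" where
  "quadratic_value M v = (\<Sum>j\<in>UNIV. (v v* M) $ j * v $ j)"

lemma quadratic_value_mult:
  fixes A :: "'r::comm_ring_1^'m::finite^'m"
  shows "quadratic_value M (v v* A) = quadratic_value (A ** M ** transpose A) v"
proof -
  have adj: "(\<Sum>j\<in>UNIV. u $ j * (v v* A) $ j) = (\<Sum>l\<in>UNIV. (u v* transpose A) $ l * v $ l)" for u
  proof -
    have "(\<Sum>j\<in>UNIV. u $ j * (v v* A) $ j) = (\<Sum>j\<in>UNIV. \<Sum>l\<in>UNIV. u $ j * A $ l $ j * v $ l)"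
      by (simp add: vector_matrix_mult_def sum_distrib_left mult_ac)
    also have "\<dots> = (\<Sum>l\<in>UNIV. \<Sum>j\<in>UNIV. u $ j * A $ l $ j * v $ l)" by (rule sum.swap)
    finally show ?thesis
      unfolding vector_matrix_mult_def transpose_def by (simp add: sum_distrib_left mult_ac)
  qed
  show ?thesis unfolding quadratic_value_def adj by (simp only: vector_matrix_mul_assoc)
qed

text \<open>Equality after multiplication by \<open>d\<close> is congruence modulo the annihilator
  of \<open>d\<close>; the value of a form respects it.\<close>

lemma quadratic_value_cong:
  fixes M N :: "'r::comm_ring_1^'m::finite^'m"
  assumes "\<And>i j. d * M $ i $ j = d * N $ i $ j"
  shows "d * quadratic_value M v = d * quadratic_value N v"
proof -
  have "d * (v v* M) $ j = d * (v v* N) $ j" for j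
  proof -
    have "d * (M $ i $ j * v $ i) = d * (N $ i $ j * v $ i)" for i
      using assms[of i j] by (simp flip: mult.assoc)
    then show ?thesis by (simp add: vector_matrix_mult_def sum_distrib_left mult_ac)
  qed
  then have "d * ((v v* M) $ j * v $ j) = d * ((v v* N) $ j * v $ j)" for j
    by (simp flip: mult.assoc)
  then show ?thesis by (simp add: quadratic_value_def sum_distrib_left)
qed

lemma quadratic_value_Q5:
  "quadratic_value Q5 v = 2 * v $ 1 * v $ 5 - 2 * v $ 2 * v $ 4 + v $ 3 * v $ 3"
  by (simp add: quadratic_value_def vector_matrix_mult_def entries5 algebra_simps)

lemma scalar_vector_matrix: "(d *s v) v* A = d *s (v v* (A :: 'r::comm_ring_1^'n::finite^'m::finite))"
  by (simp add: vec_eq_iff vector_matrix_mult_def sum_distrib_left mult_ac)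

lemma scalar_vector_matrix_cong:
  fixes A B :: "'r::comm_ring_1^'m::finite^'m"
  assumes "\<And>i j. d * A $ i $ j = d * B $ i $ j"
  shows "(d *s v) v* A = (d *s v) v* B"
proof -
  have "d * (A $ i $ j * v $ i) = d * (B $ i $ j * v $ i)" for i j
    using assms[of i j] by (simp flip: mult.assoc)
  then show ?thesis by (simp add: vec_eq_iff vector_matrix_mult_def mult_ac)
qed


section \<open>Unitary matrices acting on vectors over the residue field\<close>

context exceptional_element
begin

text \<open>Multiplication by \<open>\<delta>\<close> identifies vectors over the residue field with vectors over \<open>\<delta>R\<close>, which
  makes the reduction map unnecessary.\<close>

definition unit_vectors :: "('r^5) set" where
  "unit_vectors = {\<delta> *s v |v. \<delta> * quadratic_value Q5 v = \<delta>}"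

text \<open>Extended by the identity, so that it is a permutation of the whole type and
  \<open>sign\<close> applies.\<close>

definition action :: "'r^5^5 \<Rightarrow> 'r^5 \<Rightarrow> 'r^5" where
  "action A w = (if w \<in> unit_vectors then w v* A else w)"

text \<open>Modulo the annihilator of \<open>\<delta>\<close> the conjugate transpose agrees with
  the transpose, so a unitary matrix preserves the quadratic form of \<open>Q5\<close>.\<close>

lemma action_closed:
  assumes "A \<in> special_unitary \<theta> Q5" "w \<in> unit_vectors"
  shows "w v* A \<in> unit_vectors"
proof -
  obtain v where v: "w = \<delta> *s v" "\<delta> * quadratic_value Q5 v = \<delta>"
    using assms(2) by (auto simp: unit_vectors_def)
  have "\<delta> * (A ** Q5 ** transpose A) $ i $ j = \<delta> * Q5 $ i $ j" for i j
  proof -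
    have "\<delta> * (A ** Q5 ** transpose A) $ i $ j = (\<Sum>k\<in>UNIV. (A ** Q5) $ i $ k * (\<delta> * A $ j $ k))"
      by (simp add: matrix_matrix_mult_def[of "A ** Q5"] transpose_def sum_distrib_left mult_ac)
    also have "\<dots> = (\<Sum>k\<in>UNIV. (A ** Q5) $ i $ k * (\<delta> * \<theta> (A $ j $ k)))"
      by (simp add: delta_theta)
    also have "\<dots> = \<delta> * (A ** Q5 ** conj_transpose \<theta> A) $ i $ j"
      by (simp add: matrix_matrix_mult_def[of "A ** Q5"] conj_transpose_def entrywise_def transpose_def
        sum_distrib_left mult_ac)
    also have "\<dots> = \<delta> * Q5 $ i $ j" using assms(1) by (simp add: special_unitary_def)
    finally show ?thesis .
  qed
  then have "\<delta> * quadratic_value Q5 (v v* A) = \<delta>"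
    unfolding quadratic_value_mult using quadratic_value_cong v(2) by metis
  then show ?thesis
    unfolding v(1) scalar_vector_matrix unit_vectors_def by blast
qed

text \<open>Matrices act on row vectors from the right, which reverses the order; the sign does not
  notice.\<close>

lemma action_mult:
  assumes "A \<in> special_unitary \<theta> Q5"
  shows "action (A ** B) = action B \<circ> action A"
  using action_closed[OF assms] by (auto simp: action_def vector_matrix_mul_assoc)

lemma action_one: "action (mat 1) = id"
  by (auto simp: action_def)

definition embed :: "int \<times> int \<times> int \<times> int \<times> int \<Rightarrow> 'r^5" where
  "embed = (\<lambda>(a, b, c, d, e). \<chi> i. \<delta> * of_int
     (if i = 1 then a else if i = 2 then b else if i = 3 then c else if i = 4 then d else e))"

lemma embed_component:
  "embed (a, b, c, d, e) $ 1 = \<delta> * of_int a" "embed (a, b, c, d, e) $ 2 = \<delta> * of_int b"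
  "embed (a, b, c, d, e) $ 3 = \<delta> * of_int c" "embed (a, b, c, d, e) $ 4 = \<delta> * of_int d"
  "embed (a, b, c, d, e) $ 5 = \<delta> * of_int e"
  by (simp_all add: embed_def)

text \<open>Since \<open>3 * \<delta> = 0\<close>, only the remainder of \<open>n\<close> modulo 3
  matters, and the three multiples 0, \<open>\<delta>\<close>, \<open>- \<delta>\<close> are
  distinct.\<close>

lemma delta_of_int_iff:
  assumes "\<delta> \<noteq> 0"
  shows "\<delta> * of_int n = \<delta> \<longleftrightarrow> n mod 3 = 1"
proof -
  have "\<delta> * of_int n = \<delta> * of_int (3 * (n div 3) + n mod 3)" by simp
  also have "\<dots> = (3 * \<delta>) * of_int (n div 3) + \<delta> * of_int (n mod 3)"
    unfolding of_int_add of_int_mult by (simp add: algebra_simps)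
  also have "\<dots> = \<delta> * of_int (n mod 3)" by (simp add: three_delta)
  finally have eq: "\<delta> * of_int n = \<delta> * of_int (n mod 3)" .
  have "n mod 3 = 0 \<or> n mod 3 = 1 \<or> n mod 3 = 2" by presburger
  then show ?thesis
    using assms delta_distinct delta_double unfolding eq by (auto simp: mult.commute)
qed

lemma delta_of_int_inj:
  assumes "\<delta> \<noteq> 0" "a \<in> {- 1, 0, 1}" "b \<in> {- 1, 0, 1}" "\<delta> * of_int a = \<delta> * of_int b"
  shows "a = b"
proof -
  \<comment> \<open>The shift by 1 fits the criterion at hand, which compares with
    \<open>\<delta>\<close> and not with 0.\<close>
  have "(a - b + 1) mod 3 = 1"
    using assms(4) by (simp flip: delta_of_int_iff[OF assms(1)] add: algebra_simps)
  then show ?thesis using assms(2,3) by auto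
qed

lemma inj_embed:
  assumes "\<delta> \<noteq> 0"
  shows "inj_on embed (set residue_vectors)"
proof (rule inj_onI)
  fix x y
  assume xy: "x \<in> set residue_vectors" "y \<in> set residue_vectors" "embed x = embed y"
  obtain a b c d e a' b' c' d' e' where eq: "x = (a, b, c, d, e)" "y = (a', b', c', d', e')"
    by (metis surj_pair)
  have "\<delta> * of_int a = \<delta> * of_int a'" "\<delta> * of_int b = \<delta> * of_int b'"
    "\<delta> * of_int c = \<delta> * of_int c'" "\<delta> * of_int d = \<delta> * of_int d'"
    "\<delta> * of_int e = \<delta> * of_int e'"
    using xy(3) unfolding eq by (metis embed_component)+
  moreover have "{a, b, c, d, e} \<subseteq> {- 1, 0, 1}" "{a', b', c', d', e'} \<subseteq> {- 1, 0, 1}"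
    using xy(1,2) unfolding eq set_residue_vectors by blast+
  ultimately have "a = a'" "b = b'" "c = c'" "d = d'" "e = e'"
    unfolding insert_subset using delta_of_int_inj[OF assms] by presburger+
  then show "x = y" by (simp add: eq)
qed

text \<open>Every coordinate of \<open>\<delta> *s v\<close> is \<open>\<delta>\<close> times one of
  -1, 0, 1, and the value of the form can be computed in these integers.\<close>

lemma unit_vectors_eq:
  assumes "\<delta> \<noteq> 0"
  shows "unit_vectors = embed ` set residue_vectors"
proof -
  have quad: "\<delta> * quadratic_value Q5 v = \<delta> \<longleftrightarrow> (2 * a * e - 2 * b * d + c * c) mod 3 = 1"
    if "\<delta> *s v = embed (a, b, c, d, e)" for v a b c d e
  proof -
    have v: "\<delta> * v $ 1 = \<delta> * of_int a" "\<delta> * v $ 2 = \<delta> * of_int b" "\<delta> * v $ 3 = \<delta> * of_int c"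
      "\<delta> * v $ 4 = \<delta> * of_int d" "\<delta> * v $ 5 = \<delta> * of_int e"
      using that embed_component[of a b c d e] by (metis vector_smult_component)+
    \<comment> \<open>Only one \<open>\<delta>\<close> is available: it is spent on replacing
      \<open>x\<close>, then passed on to \<open>y\<close>.\<close>
    have prod: "\<delta> * (x * y) = \<delta> * of_int (i * j)" if "\<delta> * x = \<delta> * of_int i" "\<delta> * y = \<delta> * of_int j" for x y i j
    proof -
      have "\<delta> * (x * y) = (\<delta> * x) * y" by (rule mult.assoc[symmetric])
      also have "\<dots> = of_int i * (\<delta> * y)" unfolding that(1) by (simp only: mult_ac)
      also have "\<dots> = \<delta> * of_int (i * j)" unfolding that(2) by (simp add: mult_ac)
      finally show ?thesis .
    qed
    have "\<delta> * quadratic_value Q5 v = 2 * (\<delta> * (v $ 1 * v $ 5)) - 2 * (\<delta> * (v $ 2 * v $ 4)) + \<delta> * (v $ 3 * v $ 3)"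
      by (simp add: quadratic_value_Q5 algebra_simps)
    also have "\<dots> = \<delta> * of_int (2 * a * e - 2 * b * d + c * c)"
      unfolding prod[OF v(1,5)] prod[OF v(2,4)] prod[OF v(3,3)] by (simp add: algebra_simps)
    finally show ?thesis by (simp only: delta_of_int_iff[OF assms])
  qed
  show ?thesis
  proof (intro Set.set_eqI iffI)
    fix w assume "w \<in> unit_vectors"
    then obtain v where v: "w = \<delta> *s v" "\<delta> * quadratic_value Q5 v = \<delta>"
      by (auto simp: unit_vectors_def)
    have "\<exists>k\<in>{- 1, 0, 1 :: int}. \<delta> * r = \<delta> * of_int k" for r
      using delta_mult_cases[of r] by auto
    then have "\<forall>i. \<exists>k. k \<in> {- 1, 0, 1 :: int} \<and> \<delta> * v $ i = \<delta> * of_int k" by blast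
    then obtain k where k: "\<And>i. k i \<in> {- 1, 0, 1 :: int}" "\<And>i. \<delta> * v $ i = \<delta> * of_int (k i)"
      unfolding choice_iff by blast
    have e: "\<delta> *s v = embed (k 1, k 2, k 3, k 4, k 5)"
      by (simp add: vec_eq_iff forall_5 embed_component k(2))
    have "(k 1, k 2, k 3, k 4, k 5) \<in> set residue_vectors"
      unfolding set_residue_vectors mem_Collect_eq prod.case insert_subset
      using quad[OF e] v(2) k(1) by blast
    then show "w \<in> embed ` set residue_vectors"
      unfolding v(1) e by (rule imageI)
  next
    fix w assume "w \<in> embed ` set residue_vectors"
    then obtain a b c d e where w: "w = embed (a, b, c, d, e)" "(a, b, c, d, e) \<in> set residue_vectors"
      by auto
    define v :: "'r^5" where "v = (\<chi> i. of_int
     (if i = 1 then a else if i = 2 then b else if i = 3 then c else if i = 4 then d else e))"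
    have e: "\<delta> *s v = w" by (simp add: w(1) vec_eq_iff forall_5 embed_component v_def)
    then have "\<delta> * quadratic_value Q5 v = \<delta>"
      using quad[of v a b c d e] w unfolding set_residue_vectors mem_Collect_eq prod.case by blast
    then show "w \<in> unit_vectors" unfolding e[symmetric] unit_vectors_def by blast
  qed
qed

lemma action_permutes:
  assumes "\<delta> \<noteq> 0" "A \<in> special_unitary \<theta> Q5"
  shows "action A permutes unit_vectors"
proof (rule bij_imp_permutes)
  obtain B where B: "A ** B = mat 1" using assms(2) by (auto simp: special_unitary_def invertible_def)
  have "w = w' " if "w v* A = w' v* A" for w w' :: "'r^5"
    using arg_cong[OF that, of "\<lambda>w. w v* B"] by (simp add: vector_matrix_mul_assoc B)
  then have "inj_on (action A) unit_vectors" by (auto simp: inj_on_def action_def)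
  moreover have "action A ` unit_vectors \<subseteq> unit_vectors"
    using action_closed[OF assms(2)] by (auto simp: action_def)
  moreover have "finite unit_vectors" by (simp add: unit_vectors_eq assms(1))
  ultimately show "bij_betw (action A) unit_vectors unit_vectors"
    by (simp add: bij_betw_def endo_inj_surj)
qed (simp add: action_def)

lemma permutation_action:
  assumes "\<delta> \<noteq> 0" "A \<in> special_unitary \<theta> Q5"
  shows "permutation (action A)"
  using action_permutes[OF assms] permutation_permutes by (auto simp: unit_vectors_eq assms(1))

lemma sign_action_mult:
  assumes "\<delta> \<noteq> 0" "A \<in> special_unitary \<theta> Q5" "B \<in> special_unitary \<theta> Q5"
  shows "sign (action (A ** B)) = sign (action A) * sign (action B)"
  using assms by (simp add: action_mult sign_compose permutation_action)

lemma action_cong: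
  assumes "\<And>i j. \<delta> * A $ i $ j = \<delta> * B $ i $ j"
  shows "action A = action B"
proof
  fix w
  show "action A w = action B w"
    using scalar_vector_matrix_cong[OF assms] by (auto simp: action_def unit_vectors_def)
qed

text \<open>A sign equals its own cube, so a permutation with trivial cube is even.\<close>

lemma sign_action_order_3:
  assumes "\<delta> \<noteq> 0" "A \<in> special_unitary \<theta> Q5" "\<And>i j. \<delta> * (A ** A ** A) $ i $ j = \<delta> * mat 1 $ i $ j"
  shows "sign (action A) = 1"
proof -
  have "sign (action (A ** A ** A)) = 1" 
    using action_cong[of "A ** A ** A" "mat 1"] assms(3) by (simp add: action_one)
  then show ?thesis
    using assms(1,2) by (simp add: sign_action_mult special_unitary_mult[OF inv])
qed

lemma t4_sc_special_unitary: "t4_sc \<in> special_unitary \<theta> Q5"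
proof -
  have "det (t4_sc :: 'r^5^5) = 1"
    by (subst det_diagonal) (auto simp: t4_sc_def diag5_def munit_def prod_5)
  moreover have "t4_sc ** t4_sc = (mat 1 :: 'r^5^5)"
    by (simp add: t4_sc_def entries5)
  moreover have "t4_sc ** Q5 ** conj_transpose \<theta> t4_sc = Q5"
    by (simp add: t4_sc_def entries5 ring_involution_simps[OF inv])
  ultimately show ?thesis by (auto simp: special_unitary_def invertible_def)
qed

text \<open>On the 78 vectors with a nonzero second or fourth coordinate the torus element is an
  involution without fixed points, and it fixes everything else. It is thus a product of 39
  transpositions.\<close>

lemma sign_action_t4_sc:
  assumes "\<delta> \<noteq> 0"
  shows "sign (action t4_sc) = - 1"
proof -
  define moved where "moved = filter (\<lambda>(a, b, c, d, e). b \<noteq> 0 \<or> d \<noteq> 0) residue_vectors"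
  have sub: "set moved \<subseteq> set residue_vectors" by (auto simp: moved_def)
  have "card (embed ` set moved) = card (set moved)"
    using inj_on_subset[OF inj_embed[OF assms] sub] by (rule card_image)
  also have "\<dots> = 78"
    unfolding moved_def
    by (metis distinct_card distinct_filter distinct_residue_vectors length_moved_residue_vectors)
  finally have card: "card (embed ` set moved) = 78" .
  have t: "embed (a, b, c, d, e) v* t4_sc = embed (a, - b, c, - d, e)" for a b c d e
    by (simp add: vec_eq_iff forall_5 vector_matrix_mult_def sum_5 t4_sc_def diag5_def munit_def embed_component)
  have act: "action t4_sc (embed (a, b, c, d, e)) = embed (a, - b, c, - d, e)"
    if "(a, b, c, d, e) \<in> set residue_vectors" for a b c d e
    using that by (auto simp: action_def unit_vectors_eq[OF assms] t)
  have "even (card (embed ` set moved)) \<and>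
    sign (action t4_sc) = (- 1) ^ (card (embed ` set moved) div 2)"
  proof (rule sign_involution)
    fix w assume "w \<in> embed ` set moved"
    then obtain a b c d e where w: "w = embed (a, b, c, d, e)" and m: "(a, b, c, d, e) \<in> set moved"
      by auto
    have "- x \<in> {- 1, 0, 1}" if "x \<in> {- 1, 0, 1}" for x :: int using that by auto
    moreover have "b \<noteq> 0 \<or> d \<noteq> 0" "(a, b, c, d, e) \<in> set residue_vectors"
      using m by (simp_all add: moved_def)
    ultimately have bd: "b \<noteq> 0 \<or> d \<noteq> 0" and "(a, - b, c, - d, e) \<in> set residue_vectors"
      unfolding set_residue_vectors mem_Collect_eq prod.case insert_subset by simp_all
    then have m': "(a, - b, c, - d, e) \<in> set moved" by (simp add: moved_def)
    have "embed (a, - b, c, - d, e) \<noteq> embed (a, b, c, d, e)"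
      using inj_onD[OF inj_embed[OF assms], of "(a, - b, c, - d, e)" "(a, b, c, d, e)"] m m' sub bd by auto
    then show "action t4_sc w \<in> embed ` set moved \<and> action t4_sc w \<noteq> w \<and> action t4_sc (action t4_sc w) = w"
      using m m' act[OF subsetD[OF sub m]] act[OF subsetD[OF sub m']] by (auto simp: w)
  next
    fix w assume w: "w \<notin> embed ` set moved"
    show "action t4_sc w = w"
    proof (cases "w \<in> unit_vectors")
      case True
      then obtain a b c d e where "w = embed (a, b, c, d, e)" "(a, b, c, d, e) \<in> set residue_vectors"
        by (auto simp: unit_vectors_eq[OF assms])
      moreover from this have "b = 0" "d = 0" using w by (auto simp: moved_def)
      ultimately show ?thesis by (simp add: act)
    qed (simp add: action_def)
  qed simp
  then show ?thesis by (simp add: card)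
qed

end


section \<open>The torus elements\<close>

text \<open>Only the unit laws are assumed, so \<open>G\<close> need not be known to be a group.
  Surjectivity supplies a preimage \<open>u\<close> of the unit, and the image of the product of the
  unit with \<open>u\<close> is computed in two ways.\<close>

lemma iso_one:
  assumes "\<phi> \<in> iso G G" "\<one>\<^bsub>G\<^esub> \<in> carrier G"
    and "\<And>x. x \<in> carrier G \<Longrightarrow> \<one>\<^bsub>G\<^esub> \<otimes>\<^bsub>G\<^esub> x = x \<and> x \<otimes>\<^bsub>G\<^esub> \<one>\<^bsub>G\<^esub> = x"
  shows "\<phi> \<one>\<^bsub>G\<^esub> = \<one>\<^bsub>G\<^esub>"
proof -
  have hom: "\<phi> \<in> hom G G" and bij: "bij_betw \<phi> (carrier G) (carrier G)"
    using assms(1) by (auto simp: iso_def)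
  obtain u where u: "u \<in> carrier G" "\<phi> u = \<one>\<^bsub>G\<^esub>"
    using bij assms(2) by (metis bij_betw_iff_bijections)
  have "\<phi> \<one>\<^bsub>G\<^esub> = \<phi> \<one>\<^bsub>G\<^esub> \<otimes>\<^bsub>G\<^esub> \<phi> u"
    using assms(2,3) hom_in_carrier[OF hom assms(2)] u by simp
  also have "\<dots> = \<phi> (\<one>\<^bsub>G\<^esub> \<otimes>\<^bsub>G\<^esub> u)" using hom_mult[OF hom assms(2) u(1)] by simp
  also have "\<dots> = \<one>\<^bsub>G\<^esub>" using assms(3) u by simp
  finally show ?thesis .
qed

lemma graph_onD: "graph_on f A = R \<Longrightarrow> (x, y) \<in> R \<Longrightarrow> f x = y"
  by (auto simp: graph_on_def)

lemma hom_intertwines: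
  assumes "\<phi> \<in> hom G G" "t \<in> carrier G" "x \<in> carrier G" "x' \<in> carrier G"
    and "t \<otimes>\<^bsub>G\<^esub> x = x' \<otimes>\<^bsub>G\<^esub> t"
  shows "\<phi> t \<otimes>\<^bsub>G\<^esub> \<phi> x = \<phi> x' \<otimes>\<^bsub>G\<^esub> \<phi> t"
  using assms hom_mult by metis

definition t3 :: "'r::comm_ring_1^4^4" where
  "t3 = diag4 1 1 (-1) (-1)"

lemma t3_square: "t3 ** t3 = (mat 1 :: 'r::comm_ring_1^4^4)"
  by (simp add: t3_def entries4)

lemma det_t3: "det (t3 :: 'r::comm_ring_1^4^4) = 1"
  by (subst det_diagonal) (auto simp: t3_def diag4_def munit_def prod_4)

lemma t4_sc_square: "t4_sc ** t4_sc = (mat 1 :: 'r::comm_ring_1^5^5)"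
  by (simp add: t4_sc_def entries5)

lemma t3_intertwines:
  "t3 ** x3_2 1 = x3_2 (- 1) ** (t3 :: 'r::comm_ring_1^4^4)"
  "t3 ** transpose (x3_2 1) = transpose (x3_2 (- 1)) ** (t3 :: 'r::comm_ring_1^4^4)"
  by (simp_all add: t3_def entries4)

lemma special_unitary_in_G_ad:
  fixes Q Q' :: "'r::comm_ring_1^'m::finite^'m"
  assumes inv: "ring_involution \<theta>" and Q: "Q ** Q' = mat 1" "Q' ** Q = mat 1" and A: "A \<in> special_unitary \<theta> Q"
  shows "proj_ad A \<in> carrier (G_ad \<theta> Q)"
proof -
  obtain B where "A ** B = mat 1" "B ** A = mat 1" using A by (auto simp: special_unitary_def invertible_def)
  then show ?thesis
    using A by (rule_tac proj_ad_in_G_ad[OF inv _ _ Q, where \<nu> = 1 and \<mu> = 1])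
      (simp_all add: special_unitary_def mscale_simps)
qed

lemma special_unitary_in_G_mid:
  assumes inv: "ring_involution \<theta>" and A: "A \<in> special_unitary \<theta> Q4"
  shows "kron_square A \<in> carrier (G_mid \<theta>)"
proof -
  obtain B where "A ** B = mat 1" "B ** A = mat 1" using A by (auto simp: special_unitary_def invertible_def)
  then show ?thesis
    using A by (rule_tac kron_square_in_G_mid[OF inv, where \<nu> = 1])
      (simp_all add: special_unitary_def mscale_simps)
qed

lemma proj_ad_inverse:
  assumes "C \<in> carrier (G_ad \<theta> (Q :: 'r::comm_ring_1^'m::finite^'m))"
  obtains T T' where "C = proj_ad T" "T ** T' = mat 1" "T' ** T = mat 1"
proof -
  have "C \<in> carrier PGL" using assms by (simp add: G_ad_def)
  then show ?thesis using that unfolding carrier_PGL invertible_def by blast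
qed

section \<open>The torus elements lie in the twisted groups\<close>

context exceptional_element
begin

lemma t3_similitude: "t3 ** Q4 ** conj_transpose \<theta> t3 = (- 1) *\<^sub>m Q4"
  by (simp add: t3_def entries4 ring_involution_simps[OF inv])

lemma t3_mid_in_G_mid: "t3_mid \<in> carrier (G_mid \<theta>)"
  unfolding t3_mid_def t3_def[symmetric]
  by (rule kron_square_in_G_mid[OF inv t3_square t3_square det_t3 t3_similitude]) simp

lemma t3_ad_in_G_ad: "t3_ad \<in> carrier (G_ad \<theta> Q4)"
  unfolding t3_ad_def t3_def[symmetric]
  by (rule proj_ad_in_G_ad[OF inv t3_square t3_square Q4_inverse t3_similitude, where \<mu> = "- 1"]) simp

lemma t4_sc_in_G_sc: "t4_sc \<in> carrier (G_sc \<theta> Q5)"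
  using special_unitary_subset[OF inv Q5_inverse Q5_inverse] t4_sc_special_unitary by blast

lemma t4_ad_in_G_ad: "t4_ad \<in> carrier (G_ad \<theta> Q5)"
  unfolding t4_ad_def
  by (rule special_unitary_in_G_ad[OF inv Q5_inverse Q5_inverse t4_sc_special_unitary])

lemma x3_2_one_special_unitary:
  "x3_2 1 \<in> special_unitary \<theta> Q4" "x3_2 (- 1) \<in> special_unitary \<theta> Q4"
  "transpose (x3_2 1) \<in> special_unitary \<theta> Q4" "transpose (x3_2 (- 1)) \<in> special_unitary \<theta> Q4"
  by (auto intro!: x3_2_special_unitary[OF inv] simp: fixed_part_def ring_involution_simps[OF inv])

lemma t4_intertwines:
  "t4_sc ** x4_1 \<theta> 1 = x4_1 \<theta> (- 1) ** t4_sc"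
  "t4_sc ** transpose (x4_1 \<theta> 1) = transpose (x4_1 \<theta> (- 1)) ** t4_sc"
  by (simp_all add: t4_sc_def entries5 ring_involution_simps[OF inv])

section \<open>The torus elements lie outside the elementary subgroups\<close>

lemma E3_sc_special_unitary:
  assumes "A \<in> E3_sc \<theta>"
  shows "A \<in> special_unitary \<theta> Q4"
  using generate_G_sc_induct[OF assms[unfolded E3_sc_def] _ inv Q4_inverse, where P = "\<lambda>_. True"]
    x3_1_special_unitary[OF inv] x3_1_transpose_special_unitary[OF inv] x3_2_special_unitary[OF inv]
  by blast

text \<open>Multiplier -1 would force \<open>\<theta> c * c = - 1\<close>, hence
  \<open>\<delta> * c * c = - \<delta>\<close>; but \<open>\<delta> * c\<close> is 0 or plus or
  minus \<open>\<delta>\<close>, so \<open>\<delta> * c * c\<close> is 0 or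
  \<open>\<delta>\<close>.\<close>

lemma scaled_t3_not_special_unitary:
  assumes "\<delta> \<noteq> 0"
  shows "c *\<^sub>m t3 \<notin> special_unitary \<theta> Q4"
proof
  assume "c *\<^sub>m t3 \<in> special_unitary \<theta> Q4"
  then have "(c *\<^sub>m t3) ** Q4 ** conj_transpose \<theta> (c *\<^sub>m t3) = Q4"
    by (simp add: special_unitary_def)
  then have "(\<theta> c * c) *\<^sub>m (- 1) *\<^sub>m Q4 = (Q4 :: 'r^4^4)"
    by (simp add: conj_transpose_mscale[OF inv] t3_similitude mscale_simps)
  then have "((\<theta> c * c) *\<^sub>m (- 1) *\<^sub>m Q4) $ 1 $ 4 = (Q4 :: 'r^4^4) $ 1 $ 4" by simp
  then have "- (\<theta> c * c) = 1" by (simp add: Q4_def munit_def)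
  then have "\<delta> * (\<theta> c * c) = - \<delta>" by (metis minus_mult_right minus_minus mult.right_neutral)
  then have "\<delta> * c * c = - \<delta>" by (metis delta_theta mult.assoc)
  then show False using delta_mult_cases[of c] delta_distinct[OF assms] assms by auto
qed

text \<open>A matrix with the same Kronecker square as \<open>t3\<close> is a scalar multiple of it:
  its (1,1) entry squares to 1 and is the scalar.\<close>

lemma t3_mid_notin_E3_mid:
  assumes "\<delta> \<noteq> 0"
  shows "t3_mid \<notin> E3_mid \<theta>"
proof
  assume "t3_mid \<in> E3_mid \<theta>"
  then obtain A where A: "A \<in> E3_sc \<theta>" "kron_square t3 = kron_square A"
    by (auto simp: E3_mid_def t3_mid_def t3_def)
  have prod: "t3 $ i $ j * t3 $ k $ l = A $ i $ j * A $ k $ l" for i j k l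
    using A(2) by (metis kron_square_component)
  have one: "t3 $ 1 $ 1 = (1 :: 'r)" by (simp add: t3_def diag4_def munit_def)
  have "A $ k $ l = A $ 1 $ 1 * t3 $ k $ l" for k l
  proof -
    have "A $ k $ l = (A $ 1 $ 1 * A $ 1 $ 1) * A $ k $ l" using prod[of 1 1 1 1] one by simp
    also have "\<dots> = A $ 1 $ 1 * (A $ 1 $ 1 * A $ k $ l)" by (rule mult.assoc)
    also have "\<dots> = A $ 1 $ 1 * t3 $ k $ l" using prod[of 1 1 k l] one by simp
    finally show ?thesis .
  qed
  then have "A $ k $ l = (A $ 1 $ 1 *\<^sub>m t3) $ k $ l" for k l
    unfolding mscale_component .
  then have "\<exists>c. A = c *\<^sub>m t3" unfolding vec_eq_iff by blast
  then show False
    using scaled_t3_not_special_unitary[OF assms] E3_sc_special_unitary[OF A(1)] by blast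
qed

lemma t3_ad_notin_E3_ad:
  assumes "\<delta> \<noteq> 0"
  shows "t3_ad \<notin> E3_ad \<theta>"
proof
  assume "t3_ad \<in> E3_ad \<theta>"
  then obtain A where A: "A \<in> E3_sc \<theta>" "proj_ad A = proj_ad t3"
    by (auto simp: E3_ad_def t3_ad_def t3_def)
  then show False
    using proj_ad_eqD[OF A(2)] scaled_t3_not_special_unitary[OF assms] E3_sc_special_unitary by blast
qed

lemma delta_mult_one_plus_three:
  "\<delta> * (mat 1 + 3 *\<^sub>m N) $ i $ j = \<delta> * mat 1 $ i $ j"
  using delta_double_left(4) by (simp add: distrib_left)

lemma delta_cube_x4_1: "\<delta> * (x4_1 \<theta> t ** x4_1 \<theta> t ** x4_1 \<theta> t) $ i $ j = \<delta> * mat 1 $ i $ j"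
proof -
  have "x4_1 \<theta> t ** x4_1 \<theta> t ** x4_1 \<theta> t = mat 1 + 3 *\<^sub>m (t *\<^sub>m munit 1 2 + \<theta> t *\<^sub>m munit 4 5)"
    by (simp add: entries5)
  then show ?thesis by (simp only: delta_mult_one_plus_three)
qed

text \<open>With \<open>x4_2 \<theta> t u = mat 1 + N\<close> the cube of \<open>N\<close> vanishes,
  so the cube is 1 + 3N + 3NN, where NN contributes \<open>t * \<theta> t\<close> at (2,4).\<close>

lemma delta_cube_x4_2: "\<delta> * (x4_2 \<theta> t u ** x4_2 \<theta> t u ** x4_2 \<theta> t u) $ i $ j = \<delta> * mat 1 $ i $ j"
proof -
  have "x4_2 \<theta> t u ** x4_2 \<theta> t u ** x4_2 \<theta> t u =
      mat 1 + 3 *\<^sub>m (t *\<^sub>m munit 2 3 + \<theta> t *\<^sub>m munit 3 4 + (u + t * \<theta> t) *\<^sub>m munit 2 4)"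
    by (simp add: entries5 algebra_simps)
  then show ?thesis by (simp only: delta_mult_one_plus_three)
qed

lemma delta_cube_transpose:
  assumes "\<And>i j. \<delta> * (A ** A ** A) $ i $ j = \<delta> * mat 1 $ i $ j"
  shows "\<delta> * (transpose A ** transpose A ** transpose A) $ i $ j = \<delta> * (mat 1 :: 'r^5^5) $ i $ j"
proof -
  have "transpose A ** transpose A ** transpose A = transpose (A ** A ** A)"
    by (simp add: matrix_transpose_mul matrix_mul_assoc)
  moreover have "transpose B $ i $ j = B $ j $ i" for B :: "'r^5^5" by (simp add: transpose_def)
  moreover have "(mat 1 :: 'r^5^5) $ j $ i = mat 1 $ i $ j" by (simp add: mat_def)
  ultimately show ?thesis using assms[of j i] by simp
qed

text \<open>The sign of the action is multiplicative, and the root elements have trivial cube modulo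
  the annihilator of \<open>\<delta>\<close>.\<close>

lemma E4_sc_even:
  assumes "A \<in> E4_sc \<theta>" "\<delta> \<noteq> 0"
  shows "A \<in> special_unitary \<theta> Q5 \<and> sign (action A) = 1"
proof (rule generate_G_sc_induct[OF assms(1)[unfolded E4_sc_def] _ inv Q5_inverse Q5_inverse])
  let ?S = "{x4_1 \<theta> t |t. True} \<union> {transpose (x4_1 \<theta> t) |t. True} \<union>
      {x4_2 \<theta> t u |t u. (t, u) \<in> root_params \<theta>} \<union>
      {transpose (x4_2 \<theta> t u) |t u. (t, u) \<in> root_params \<theta>}"
  show S: "?S \<subseteq> special_unitary \<theta> Q5"
    using x4_1_special_unitary[OF inv] x4_2_special_unitary[OF inv] by blast
  show one: "sign (action (mat 1)) = 1" by (simp add: action_one)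
  show even: "sign (action A) = 1" if "A \<in> ?S" for A
  proof (rule sign_action_order_3[OF assms(2)])
    show "A \<in> special_unitary \<theta> Q5" using S that by blast
    show "\<delta> * (A ** A ** A) $ i $ j = \<delta> * mat 1 $ i $ j" for i j
      using that delta_cube_x4_1 delta_cube_x4_2 delta_cube_transpose[OF delta_cube_x4_1]
        delta_cube_transpose[OF delta_cube_x4_2] by blast
  qed
  show "sign (action B) = 1" if "A \<in> ?S" "B \<in> special_unitary \<theta> Q5" "A ** B = mat 1" for A B
    using sign_action_mult[OF assms(2) subsetD[OF S that(1)] that(2)] even[OF that(1)] one that(3)
    by simp
  show "sign (action (A ** B)) = 1"
    if "A \<in> special_unitary \<theta> Q5" "B \<in> special_unitary \<theta> Q5" "sign (action A) = 1" "sign (action B) = 1" for A B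
    using that by (simp add: sign_action_mult assms(2))
qed

text \<open>The scalar \<open>c\<close> is needed for the adjoint group. Unitarity gives
  \<open>\<delta> * c * c = \<delta>\<close> and the determinant gives \<open>c ^ 5 = 1\<close>;
  together \<open>\<delta> * c = \<delta>\<close>. So \<open>c\<close> acts trivially and the odd
  sign of \<open>t4_sc\<close> remains.\<close>

lemma scaled_t4_notin_E4_sc:
  assumes "\<delta> \<noteq> 0"
  shows "c *\<^sub>m t4_sc \<notin> E4_sc \<theta>"
proof
  let ?A = "c *\<^sub>m (t4_sc :: 'r^5^5)"
  assume "?A \<in> E4_sc \<theta>"
  then have U: "?A \<in> special_unitary \<theta> Q5" and even: "sign (action ?A) = 1"
    using E4_sc_even assms by auto
  have t: "t4_sc ** Q5 ** conj_transpose \<theta> t4_sc = Q5" "det (t4_sc :: 'r^5^5) = 1"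
    using t4_sc_special_unitary by (auto simp: special_unitary_def)
  have "?A ** Q5 ** conj_transpose \<theta> ?A = Q5" using U by (simp add: special_unitary_def)
  then have "(\<theta> c * c) *\<^sub>m Q5 = (Q5 :: 'r^5^5)"
    by (simp add: conj_transpose_mscale[OF inv] t mscale_simps)
  then have "((\<theta> c * c) *\<^sub>m Q5) $ 1 $ 5 = (Q5 :: 'r^5^5) $ 1 $ 5" by simp
  then have "\<theta> c * c = 1" by (simp add: Q5_def munit_def)
  then have sq: "\<delta> * c * c = \<delta>" by (metis delta_theta mult.assoc mult.right_neutral)
  have "det ?A = det (mat c ** (t4_sc :: 'r^5^5))" by (simp add: mat_mult_eq_mscale)
  also have "\<dots> = c ^ 5" unfolding det_mul t by (subst det_diagonal) (auto simp: mat_def)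
  finally have "c ^ 5 = 1" using U by (simp add: special_unitary_def)
  then have "\<delta> * c * c * c * c * c = \<delta>" by (simp add: mult.assoc flip: power_Suc) (simp add: eval_nat_numeral mult.assoc)
  then have "\<delta> * c = \<delta>" by (simp add: sq)
  then have "action ?A = action t4_sc"
    by (intro action_cong) (simp flip: mult.assoc)
  then show False using even sign_action_t4_sc[OF assms] by simp
qed

lemma t4_sc_notin_E4_sc:
  assumes "\<delta> \<noteq> 0"
  shows "t4_sc \<notin> E4_sc \<theta>"
  using scaled_t4_notin_E4_sc[OF assms, of 1] by (simp add: mscale_simps)

lemma t4_ad_notin_E4_ad:
  assumes "\<delta> \<noteq> 0"
  shows "t4_ad \<notin> E4_ad \<theta>"
proof
  assume "t4_ad \<in> E4_ad \<theta>"
  then obtain A where A: "A \<in> E4_sc \<theta>" "proj_ad A = proj_ad t4_sc"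
    by (auto simp: E4_ad_def t4_ad_def)
  then show False
    using proj_ad_eqD[OF A(2)] scaled_t4_notin_E4_sc[OF assms] by blast
qed

section \<open>Extensions of the exceptional automorphisms\<close>

lemma y3_in_Theta3_sc:
  assumes "s \<in> fixed_part \<theta>"
  shows "(x3_2 s, y3_pos \<delta> s) \<in> Theta3_sc \<theta> \<delta>" "(transpose (x3_2 s), y3_neg \<delta> s) \<in> Theta3_sc \<theta> \<delta>"
  unfolding Theta3_sc_def y3_pos_def y3_neg_def
  by (rule generate.incl; use assms in \<open>unfold Theta3_gens_def, blast\<close>)+

lemma y3_one_in_Theta3_sc:
  "(x3_2 1, y3_pos \<delta> 1) \<in> Theta3_sc \<theta> \<delta>" "(x3_2 (- 1), y3_pos \<delta> (- 1)) \<in> Theta3_sc \<theta> \<delta>"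
  "(transpose (x3_2 1), y3_neg \<delta> 1) \<in> Theta3_sc \<theta> \<delta>"
  "(transpose (x3_2 (- 1)), y3_neg \<delta> (- 1)) \<in> Theta3_sc \<theta> \<delta>"
  by (auto intro!: y3_in_Theta3_sc simp: fixed_part_def ring_involution_simps[OF inv])

lemma y4_in_Theta4_sc:
  assumes "sym_part \<theta> p = p"
  shows "(x4_1 \<theta> p, y4_pos \<theta> \<delta> p) \<in> Theta4_sc \<theta> \<delta>"
    "(transpose (x4_1 \<theta> p), y4_neg \<theta> \<delta> p) \<in> Theta4_sc \<theta> \<delta>"
  unfolding Theta4_sc_def y4_pos_def y4_neg_def
  by (rule generate.incl; use assms[symmetric] in \<open>unfold Theta4_gens_def, blast\<close>)+

lemma y4_one_in_Theta4_sc: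
  "(x4_1 \<theta> 1, y4_pos \<theta> \<delta> 1) \<in> Theta4_sc \<theta> \<delta>" "(x4_1 \<theta> (- 1), y4_pos \<theta> \<delta> (- 1)) \<in> Theta4_sc \<theta> \<delta>"
  "(transpose (x4_1 \<theta> 1), y4_neg \<theta> \<delta> 1) \<in> Theta4_sc \<theta> \<delta>"
  "(transpose (x4_1 \<theta> (- 1)), y4_neg \<theta> \<delta> (- 1)) \<in> Theta4_sc \<theta> \<delta>"
  by (intro y4_in_Theta4_sc sym_part_eqI; simp add: ring_involution_simps[OF inv])+

text \<open>The image of the torus element squares to 1, so it is its own inverse, and it inherits
  the symmetry from being a point of \<open>SL4_mod_mu2\<close>.\<close>

lemma extension_mid_imp_zero:
  assumes \<phi>: "\<phi> \<in> iso (G_mid \<theta>) (G_mid \<theta>)" and graph: "graph_on \<phi> (E3_mid \<theta>) = Theta3_mid \<theta> \<delta>"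
  shows "\<delta> = 0"
proof -
  have hom: "\<phi> \<in> hom (G_mid \<theta>) (G_mid \<theta>)" using \<phi> by (simp add: iso_def)
  have mult: "X \<otimes>\<^bsub>G_mid \<theta>\<^esub> Y = X ** Y" for X Y
    by (simp add: G_mid_def SL4_mod_mu2_def)
  have one: "\<one>\<^bsub>G_mid \<theta>\<^esub> = mat 1" by (simp add: G_mid_def SL4_mod_mu2_def)
  have t: "kron_square t3 \<in> carrier (G_mid \<theta>)"
    using t3_mid_in_G_mid by (simp add: t3_mid_def t3_def)
  have sq: "kron_square t3 ** kron_square t3 = (mat 1 :: 'r^(4 \<times> 4)^(4 \<times> 4))"
    by (simp add: t3_square kron_square_one flip: kron_square_mult)
  have "mat 1 ** Q4 ** conj_transpose \<theta> (mat 1) = 1 *\<^sub>m Q4"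
    by (simp add: conj_transpose_one[OF inv] mscale_simps)
  then have "kron_square (mat 1) \<in> carrier (G_mid \<theta>)"
    by (rule kron_square_in_G_mid[OF inv, rotated 3, where B = "mat 1"]) simp_all
  then have "\<phi> (mat 1) = mat 1"
    using iso_one[OF \<phi>] by (simp add: mult one kron_square_one)
  then have "\<phi> (kron_square t3) ** \<phi> (kron_square t3) = mat 1"
    using hom_mult[OF hom t t] by (simp add: mult sq)
  moreover have "\<phi> (kron_square t3) $ (i, k) $ (j, l) = \<phi> (kron_square t3) $ (k, i) $ (l, j)" for i j k l
    using hom_in_carrier[OF hom t] by (simp add: G_mid_def SL4_mod_mu2_def)
  moreover have val: "\<phi> (kron_square x) = kron_square y" if "(x, y) \<in> Theta3_sc \<theta> \<delta>" for x y
    using graph_onD[OF graph] that unfolding Theta3_mid_def by force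
  have rel: "\<phi> (kron_square t3) ** kron_square y = kron_square y' ** \<phi> (kron_square t3)"
    if "(x, y) \<in> Theta3_sc \<theta> \<delta>" "(x', y') \<in> Theta3_sc \<theta> \<delta>" "t3 ** x = x' ** t3"
      "x \<in> special_unitary \<theta> Q4" "x' \<in> special_unitary \<theta> Q4" for x x' y y'
    using hom_intertwines[OF hom t, of "kron_square x" "kron_square x'"] that special_unitary_in_G_mid[OF inv]
    by (simp add: mult val flip: kron_square_mult)
  ultimately show ?thesis
    using delta_eq_zero_3_mid rel[OF y3_one_in_Theta3_sc(1,2) t3_intertwines(1) x3_2_one_special_unitary(1,2)]
      rel[OF y3_one_in_Theta3_sc(3,4) t3_intertwines(2) x3_2_one_special_unitary(3,4)]
    by blast
qed

text \<open>Shared by n = 3 and n = 4. \<open>T\<close> is a representative of the image of the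
  class of \<open>t\<close>; relations between classes hold for representatives up to a scalar
  \<open>c\<close>, which may depend on the pair.\<close>

lemma extension_ad_intertwines:
  fixes Q Q' t :: "'r^'m::finite^'m"
  assumes Q: "Q ** Q' = mat 1" "Q' ** Q = mat 1"
    and \<phi>: "\<phi> \<in> iso (G_ad \<theta> Q) (G_ad \<theta> Q)" and t: "proj_ad t \<in> carrier (G_ad \<theta> Q)"
  obtains T T' where "T ** T' = mat 1" "T' ** T = mat 1"
    "\<And>x x' y y'. \<phi> (proj_ad x) = proj_ad y \<Longrightarrow> \<phi> (proj_ad x') = proj_ad y' \<Longrightarrow> t ** x = x' ** t \<Longrightarrow>
      x \<in> special_unitary \<theta> Q \<Longrightarrow> x' \<in> special_unitary \<theta> Q \<Longrightarrow> \<exists>c. T ** y = c *\<^sub>m (y' ** T)"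
proof -
  have hom: "\<phi> \<in> hom (G_ad \<theta> Q) (G_ad \<theta> Q)" using \<phi> by (simp add: iso_def)
  have mult: "proj_ad X \<otimes>\<^bsub>G_ad \<theta> Q\<^esub> proj_ad Y = proj_ad (X ** Y)" for X Y
    by (simp add: G_ad_def PGL_def FactGroup_def proj_ad_mult)
  obtain T T' where T: "\<phi> (proj_ad t) = proj_ad T" "T ** T' = mat 1" "T' ** T = mat 1"
    using proj_ad_inverse[OF hom_in_carrier[OF hom t]] by blast
  have "\<exists>c. T ** y = c *\<^sub>m (y' ** T)"
    if "\<phi> (proj_ad x) = proj_ad y" "\<phi> (proj_ad x') = proj_ad y'" "t ** x = x' ** t"
      "x \<in> special_unitary \<theta> Q" "x' \<in> special_unitary \<theta> Q" for x x' y y'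
  proof -
    have "proj_ad (T ** y) = proj_ad (y' ** T)"
      using hom_intertwines[OF hom t, of "proj_ad x" "proj_ad x'"] that special_unitary_in_G_ad[OF inv Q]
      by (simp add: mult T(1))
    then show ?thesis using proj_ad_eqD by blast
  qed
  then show ?thesis using that T by blast
qed

lemma extension_3_ad_imp_zero:
  assumes \<phi>: "\<phi> \<in> iso (G_ad \<theta> Q4) (G_ad \<theta> Q4)" and graph: "graph_on \<phi> (E3_ad \<theta>) = Theta3_ad \<theta> \<delta>"
  shows "\<delta> = 0"
proof -
  have val: "\<phi> (proj_ad x) = proj_ad y" if "(x, y) \<in> Theta3_sc \<theta> \<delta>" for x y
    using graph_onD[OF graph] that unfolding Theta3_ad_def by force
  have t: "proj_ad t3 \<in> carrier (G_ad \<theta> Q4)"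
    using t3_ad_in_G_ad by (simp add: t3_ad_def t3_def)
  obtain T T' where T: "T ** T' = mat 1" "T' ** T = mat 1"
    and rel: "\<And>x x' y y'. \<phi> (proj_ad x) = proj_ad y \<Longrightarrow> \<phi> (proj_ad x') = proj_ad y' \<Longrightarrow> t3 ** x = x' ** t3 \<Longrightarrow>
      x \<in> special_unitary \<theta> Q4 \<Longrightarrow> x' \<in> special_unitary \<theta> Q4 \<Longrightarrow> \<exists>c. T ** y = c *\<^sub>m (y' ** T)"
    using extension_ad_intertwines[OF Q4_inverse \<phi> t] by blast
  note theta = y3_one_in_Theta3_sc[THEN val] and su = x3_2_one_special_unitary
  show ?thesis
    using delta_eq_zero_3_ad[OF T] rel[OF theta(1,2) t3_intertwines(1) su(1,2)]
      rel[OF theta(3,4) t3_intertwines(2) su(3,4)] by blast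
qed

lemma extension_4_ad_imp_zero:
  assumes \<phi>: "\<phi> \<in> iso (G_ad \<theta> Q5) (G_ad \<theta> Q5)" and graph: "graph_on \<phi> (E4_ad \<theta>) = Theta4_ad \<theta> \<delta>"
  shows "\<delta> = 0"
proof -
  have val: "\<phi> (proj_ad x) = proj_ad y" if "(x, y) \<in> Theta4_sc \<theta> \<delta>" for x y
    using graph_onD[OF graph] that unfolding Theta4_ad_def by force
  have t: "proj_ad t4_sc \<in> carrier (G_ad \<theta> Q5)"
    using t4_ad_in_G_ad by (simp add: t4_ad_def)
  obtain T T' where T: "T ** T' = mat 1" "T' ** T = mat 1"
    and rel: "\<And>x x' y y'. \<phi> (proj_ad x) = proj_ad y \<Longrightarrow> \<phi> (proj_ad x') = proj_ad y' \<Longrightarrow> t4_sc ** x = x' ** t4_sc \<Longrightarrow>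
      x \<in> special_unitary \<theta> Q5 \<Longrightarrow> x' \<in> special_unitary \<theta> Q5 \<Longrightarrow> \<exists>c. T ** y = c *\<^sub>m (y' ** T)"
    using extension_ad_intertwines[OF Q5_inverse Q5_inverse \<phi> t] by blast
  note theta = y4_one_in_Theta4_sc[THEN val] and su = x4_1_special_unitary[OF inv]
  show ?thesis
    using delta_eq_zero_4_ad[OF T] rel[OF theta(1,2) t4_intertwines(1) su(1,1)]
      rel[OF theta(3,4) t4_intertwines(2) su(2,2)] by blast
qed

lemma extension_4_sc_imp_zero:
  assumes \<phi>: "\<phi> \<in> iso (G_sc \<theta> Q5) (G_sc \<theta> Q5)" and graph: "graph_on \<phi> (E4_sc \<theta>) = Theta4_sc \<theta> \<delta>"
  shows "\<delta> = 0"
proof -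
  have hom: "\<phi> \<in> hom (G_sc \<theta> Q5) (G_sc \<theta> Q5)" using \<phi> by (simp add: iso_def)
  have mult: "X \<otimes>\<^bsub>G_sc \<theta> Q5\<^esub> Y = X ** Y" and one: "\<one>\<^bsub>G_sc \<theta> Q5\<^esub> = mat 1" for X Y
    by (simp_all add: G_sc_def SL_def GL_def)
  have sub: "x \<in> carrier (G_sc \<theta> Q5)" if "x \<in> special_unitary \<theta> Q5" for x
    using special_unitary_subset[OF inv Q5_inverse Q5_inverse] that by blast
  have "mat 1 \<in> special_unitary \<theta> Q5"
    using special_unitary_mult[OF inv t4_sc_special_unitary t4_sc_special_unitary] by (simp add: t4_sc_square)
  then have "\<phi> (mat 1) = mat 1"
    using iso_one[OF \<phi>] sub by (simp add: mult one)
  then have inverse: "\<phi> t4_sc ** \<phi> t4_sc = mat 1"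
    using hom_mult[OF hom t4_sc_in_G_sc t4_sc_in_G_sc] by (simp add: mult t4_sc_square)
  have val: "\<phi> x = y" if "(x, y) \<in> Theta4_sc \<theta> \<delta>" for x y
    using graph_onD[OF graph that] .
  have rel: "\<phi> t4_sc ** y = y' ** \<phi> t4_sc"
    if "(x, y) \<in> Theta4_sc \<theta> \<delta>" "(x', y') \<in> Theta4_sc \<theta> \<delta>" "t4_sc ** x = x' ** t4_sc"
      "x \<in> special_unitary \<theta> Q5" "x' \<in> special_unitary \<theta> Q5" for x x' y y'
    using hom_intertwines[OF hom t4_sc_in_G_sc, of x x'] that sub by (simp add: mult val)
  note su = x4_1_special_unitary[OF inv]
  show ?thesis
    using delta_eq_zero_4[OF inverse] rel[OF y4_one_in_Theta4_sc(1,2) t4_intertwines(1) su(1,1)]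
      rel[OF y4_one_in_Theta4_sc(3,4) t4_intertwines(2) su(2,2)]
    by blast
qed

end

theorem proposition5p3:
  fixes \<theta> :: "'r::comm_ring_1 \<Rightarrow> 'r"
  assumes "local_ring TYPE('r)"
    and "(2::'r) dvd 1"
    and "ring_involution \<theta>"
    and "\<theta> \<noteq> id"
  shows "(exceptional_set \<theta> \<noteq> {0} \<longrightarrow>
            (t3_mid \<notin> E3_mid \<theta> \<and> E3_mid \<theta> \<noteq> carrier (G_mid \<theta>)) \<and>
            (t3_ad \<notin> E3_ad \<theta> \<and> E3_ad \<theta> \<noteq> carrier (G_ad \<theta> Q4)) \<and>
            (t4_sc \<notin> E4_sc \<theta> \<and> E4_sc \<theta> \<noteq> carrier (G_sc \<theta> Q5)) \<and>
            (t4_ad \<notin> E4_ad \<theta> \<and> E4_ad \<theta> \<noteq> carrier (G_ad \<theta> Q5))) \<and>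
         (\<forall>\<delta>\<in>exceptional_set \<theta>.
            ((\<exists>\<phi>\<in>iso (G_mid \<theta>) (G_mid \<theta>).
                graph_on \<phi> (E3_mid \<theta>) = Theta3_mid \<theta> \<delta>) \<longrightarrow> \<delta> = 0) \<and>
            ((\<exists>\<phi>\<in>iso (G_ad \<theta> Q4) (G_ad \<theta> Q4).
                graph_on \<phi> (E3_ad \<theta>) = Theta3_ad \<theta> \<delta>) \<longrightarrow> \<delta> = 0) \<and>
            ((\<exists>\<phi>\<in>iso (G_sc \<theta> Q5) (G_sc \<theta> Q5).
                graph_on \<phi> (E4_sc \<theta>) = Theta4_sc \<theta> \<delta>) \<longrightarrow> \<delta> = 0) \<and>
            ((\<exists>\<phi>\<in>iso (G_ad \<theta> Q5) (G_ad \<theta> Q5).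
                graph_on \<phi> (E4_ad \<theta>) = Theta4_ad \<theta> \<delta>) \<longrightarrow> \<delta> = 0))"
proof (intro conjI impI ballI)
  assume "exceptional_set \<theta> \<noteq> {0}"
  then obtain \<delta> where "\<delta> \<in> exceptional_set \<theta>" and nz: "\<delta> \<noteq> 0"
    using zero_in_exceptional_set[OF assms(3)] by blast
  then interpret exceptional_element \<theta> \<delta>
    using assms by unfold_locales
  note notin = t3_mid_notin_E3_mid[OF nz] t3_ad_notin_E3_ad[OF nz]
    t4_sc_notin_E4_sc[OF nz] t4_ad_notin_E4_ad[OF nz]
  show "t3_mid \<notin> E3_mid \<theta>" "t3_ad \<notin> E3_ad \<theta>" "t4_sc \<notin> E4_sc \<theta>" "t4_ad \<notin> E4_ad \<theta>"
    by (fact notin)+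
  show "E3_mid \<theta> \<noteq> carrier (G_mid \<theta>)" "E3_ad \<theta> \<noteq> carrier (G_ad \<theta> Q4)"
    "E4_sc \<theta> \<noteq> carrier (G_sc \<theta> Q5)" "E4_ad \<theta> \<noteq> carrier (G_ad \<theta> Q5)"
    using notin t3_mid_in_G_mid t3_ad_in_G_ad t4_sc_in_G_sc t4_ad_in_G_ad by blast+
next
  fix \<delta> assume "\<delta> \<in> exceptional_set \<theta>"
  then interpret exceptional_element \<theta> \<delta>
    using assms by unfold_locales
  show "\<delta> = 0" if "\<exists>\<phi>\<in>iso (G_mid \<theta>) (G_mid \<theta>). graph_on \<phi> (E3_mid \<theta>) = Theta3_mid \<theta> \<delta>"
    using that extension_mid_imp_zero by blast
  show "\<delta> = 0" if "\<exists>\<phi>\<in>iso (G_ad \<theta> Q4) (G_ad \<theta> Q4). graph_on \<phi> (E3_ad \<theta>) = Theta3_ad \<theta> \<delta>"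
    using that extension_3_ad_imp_zero by blast
  show "\<delta> = 0" if "\<exists>\<phi>\<in>iso (G_sc \<theta> Q5) (G_sc \<theta> Q5). graph_on \<phi> (E4_sc \<theta>) = Theta4_sc \<theta> \<delta>"
    using that extension_4_sc_imp_zero by blast
  show "\<delta> = 0" if "\<exists>\<phi>\<in>iso (G_ad \<theta> Q5) (G_ad \<theta> Q5). graph_on \<phi> (E4_ad \<theta>) = Theta4_ad \<theta> \<delta>"
    using that extension_4_ad_imp_zero by blast
qed

end
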